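(* Let $K\subset\mathbb{R}^d$ be a self-affine sponge of Lalley-Gatzouras type, the attractor of an IFS $\Phi$ of Lalley-Gatzouras type. Then the following three statements are equivalent. (i) $K$ is uniformly disconnected. (ii) All $\bar\pi_\ell(K)$, $1\le\ell\le d$, are totally disconnected. (iii) The attractor of every fiber IFS of $K$ (of every rank $0,1,\dots,d-1$) is different from $[0,1]$.
   Context: **Self-affine sponge of Lalley-Gatzouras type.** A diagonal self-affine IFS on $\mathbb{R}^d$ ($d\ge 1$) is a finite family $\Phi=\{\phi_k\}_{k=1}^N$ of maps $\phi_k(x)=T_kx+b_k$ with $b_k\in\mathbb{R}^d$ and $T_k=\mathrm{diag}(T_{k,1},\dots,T_{k,d})$, $0<T_{k,i}<1$. Its attractor is the unique nonempty compact set $K\subset\mathbb{R}^d$ with $K=\bigcup_{k=1}^N\phi_k(K)$; it is always assumed that $K\subset[0,1]^d$. For $1\le i\le d$ let $\bar\pi_i(x_1,\dots,x_d)=(x_1,\dots,x_i)$ and let $\Phi_{\{1,\dots,i\}}$ be the set (each map counted once) of maps $y\mapsto \mathrm{diag}(T_{k,1},\dots,T_{k,i})y+\bar\pi_i(b_k)$ on $\mathbb{R}^i$, $1\le k\le N$. $\Phi$ satisfies the coordinate ordering condition if $T_{k,1}>T_{k,2}>\cdots>T_{k,d}$ for all $k$. $\Phi$ satisfies the neat projection condition if for each $1\le i\le d$ the IFS $\Phi_{\{1,\dots,i\}}$ satisfies the open set condition with the open unit cube $(0,1)^i$, i.e. $f((0,1)^i)\subset(0,1)^i$ for all $f\in\Phi_{\{1,\dots,i\}}$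 and the sets $f((0,1)^i)$, $f\in\Phi_{\{1,\dots,i\}}$, are pairwise disjoint. $K$ (and $\Phi$) is of Lalley-Gatzouras type if both conditions hold. $K$ carries the Euclidean metric. **Fiber IFS.** The fiber IFS of rank $0$ is $G(\emptyset)=\Phi_{\{1\}}$. For $1\le\ell\le d-1$ and $u\in\Phi_{\{1,\dots,\ell\}}$, the set $G(u)=\{h:\ (u,h)\in\Phi_{\{1,\dots,\ell+1\}}\}$ is called a fiber IFS of rank $\ell$; here $h(x)=ax+b$ with $0<a<1$ and $(u,h)(x_1,\dots,x_{\ell+1})=(u(x_1,\dots,x_\ell),h(x_{\ell+1}))$. Each $G(u)$ is a finite IFS of affine contractions mapping $[0,1]$ into itself. **Uniformly disconnected.** For $\delta_0>0$, a $\delta_0$-sequence in a metric space $(X,\rho)$ is a sequence of distinct points $(x_0,x_1,\dots,x_n)$, $n\ge1$, with $\rho(x_i,x_{i+1})\le\delta_0\,\rho(x_0,x_n)$ for all $0\le i\le n-1$. $(X,\rho)$ is uniformly disconnected if there is $\delta_0>0$ such that no $\delta_0$-sequence exists in $X$. *)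

theory Defs
  imports "HOL-Analysis.Analysis"
begin

text \<open>The dimension has to vary inside one statement, so points of the \<open>n\<close>-dimensional space are
  the elements of \<^term>\<open>topspace (Euclidean_space n)\<close>: functions \<^typ>\<open>nat \<Rightarrow> real\<close> that vanish at
  every index \<open>\<ge> n\<close>. Coordinates are numbered from \<open>0\<close>, so the \<open>i\<close>-th coordinate of the usual
  notation is \<open>x (i - 1)\<close>.\<close>

definition coord_proj :: "nat \<Rightarrow> (nat \<Rightarrow> real) \<Rightarrow> (nat \<Rightarrow> real)" where
  "coord_proj n x = (\<lambda>i. if i < n then x i else 0)"

definition eucl_dist :: "nat \<Rightarrow> (nat \<Rightarrow> real) \<Rightarrow> (nat \<Rightarrow> real) \<Rightarrow> real" where
  "eucl_dist n x y = L2_set (\<lambda>i. x i - y i) {..<n}"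

definition closed_unit_cube :: "nat \<Rightarrow> (nat \<Rightarrow> real) set" where
  "closed_unit_cube n = {x \<in> topspace (Euclidean_space n). \<forall>i<n. 0 \<le> x i \<and> x i \<le> 1}"

definition open_unit_cube :: "nat \<Rightarrow> (nat \<Rightarrow> real) set" where
  "open_unit_cube n = {x \<in> topspace (Euclidean_space n). \<forall>i<n. 0 < x i \<and> x i < 1}"


subsection \<open>Iterated function systems\<close>

text \<open>For a finite nonempty set of contractions of a complete metric space there is exactly one such
  \<open>A\<close> (Hutchinson), so this says that \<open>A\<close> is the attractor of \<open>F\<close>.\<close>

definition is_attractor :: "'a topology \<Rightarrow> ('a \<Rightarrow> 'a) set \<Rightarrow> 'a set \<Rightarrow> bool" where
  "is_attractor X F A \<longleftrightarrow> A \<noteq> {} \<and> compactin X A \<and> A = (\<Union>f\<in>F. f ` A)"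

text \<open>The map \<open>x \<mapsto> diag(t\<^sub>0, \<dots>, t\<^sub>n\<^sub>-\<^sub>1) x + (c\<^sub>0, \<dots>, c\<^sub>n\<^sub>-\<^sub>1)\<close>; entries of \<open>t\<close>, \<open>c\<close>
  and \<open>x\<close> with index \<open>\<ge> n\<close> are ignored. Hence two such maps are equal as functions on
  \<^typ>\<open>nat \<Rightarrow> real\<close> iff they agree on the \<open>n\<close>-dimensional space.\<close>

definition diag_affine ::
    "nat \<Rightarrow> (nat \<Rightarrow> real) \<Rightarrow> (nat \<Rightarrow> real) \<Rightarrow> (nat \<Rightarrow> real) \<Rightarrow> (nat \<Rightarrow> real)" where
  "diag_affine n t c x = (\<lambda>i. if i < n then t i * x i + c i else 0)"

text \<open>The family has \<open>N\<close> members with linear parts \<open>T k\<close> and translations \<open>b k\<close>, \<open>k < N\<close>. Being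
  a set, \<open>projected_ifs N T b n\<close> counts coinciding projected maps once; for \<open>n = d\<close> it is the
  original system, and for \<open>n = 0\<close>, \<open>N > 0\<close> it consists of the only map of the one-point space.\<close>

definition projected_ifs ::
    "nat \<Rightarrow> (nat \<Rightarrow> nat \<Rightarrow> real) \<Rightarrow> (nat \<Rightarrow> nat \<Rightarrow> real) \<Rightarrow> nat
      \<Rightarrow> ((nat \<Rightarrow> real) \<Rightarrow> (nat \<Rightarrow> real)) set" where
  "projected_ifs N T b n = (\<lambda>k. diag_affine n (T k) (b k)) ` {..<N}"

definition diagonal_contractive :: "nat \<Rightarrow> nat \<Rightarrow> (nat \<Rightarrow> nat \<Rightarrow> real) \<Rightarrow> bool" where
  "diagonal_contractive d N T \<longleftrightarrow> (\<forall>k<N. \<forall>i<d. 0 < T k i \<and> T k i < 1)"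

definition coordinate_ordering :: "nat \<Rightarrow> nat \<Rightarrow> (nat \<Rightarrow> nat \<Rightarrow> real) \<Rightarrow> bool" where
  "coordinate_ordering d N T \<longleftrightarrow> (\<forall>k<N. \<forall>i. Suc i < d \<longrightarrow> T k i > T k (Suc i))"

definition open_set_condition_with ::
    "('a \<Rightarrow> 'a) set \<Rightarrow> 'a set \<Rightarrow> bool" where
  "open_set_condition_with F U \<longleftrightarrow>
     (\<forall>f\<in>F. f ` U \<subseteq> U) \<and> disjoint_family_on (\<lambda>f. f ` U) F"

definition neat_projection ::
    "nat \<Rightarrow> nat \<Rightarrow> (nat \<Rightarrow> nat \<Rightarrow> real) \<Rightarrow> (nat \<Rightarrow> nat \<Rightarrow> real) \<Rightarrow> bool" where
  "neat_projection d N T b \<longleftrightarrow>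
     (\<forall>n\<in>{1..d}. open_set_condition_with (projected_ifs N T b n) (open_unit_cube n))"

definition lalley_gatzouras ::
    "nat \<Rightarrow> nat \<Rightarrow> (nat \<Rightarrow> nat \<Rightarrow> real) \<Rightarrow> (nat \<Rightarrow> nat \<Rightarrow> real) \<Rightarrow> bool" where
  "lalley_gatzouras d N T b \<longleftrightarrow>
     diagonal_contractive d N T \<and> coordinate_ordering d N T \<and> neat_projection d N T b"


subsection \<open>Fiber systems\<close>

text \<open>\<open>join_map l u h\<close> is the map \<open>(u, h)\<close> of the \<open>(l + 1)\<close>-dimensional space: \<open>u\<close> acts on the
  first \<open>l\<close> coordinates and \<open>h\<close> on the last one.\<close>

definition join_map ::
    "nat \<Rightarrow> ((nat \<Rightarrow> real) \<Rightarrow> (nat \<Rightarrow> real)) \<Rightarrow> (real \<Rightarrow> real) \<Rightarrow> (nat \<Rightarrow> real) \<Rightarrow> (nat \<Rightarrow> real)" where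
  "join_map l u h x =
     (\<lambda>i. if i < l then u (coord_proj l x) i else if i = l then h (x l) else 0)"

definition fiber_ifs ::
    "nat \<Rightarrow> (nat \<Rightarrow> nat \<Rightarrow> real) \<Rightarrow> (nat \<Rightarrow> nat \<Rightarrow> real) \<Rightarrow> nat
      \<Rightarrow> ((nat \<Rightarrow> real) \<Rightarrow> (nat \<Rightarrow> real)) \<Rightarrow> (real \<Rightarrow> real) set" where
  "fiber_ifs N T b l u =
     {h. (\<exists>a c. 0 < a \<and> a < 1 \<and> h = (\<lambda>x. a * x + c)) \<and>
         join_map l u h \<in> projected_ifs N T b (Suc l)}"

text \<open>The rank 0 case needs no separate definition: with the unique map \<open>u\<close> of the one-point space,
  \<^term>\<open>fiber_ifs N T b 0 u\<close> is the system projected to the first coordinate axis, read as a system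
  of maps of the real line.\<close>

lemma fiber_ifs_rank_0:
  assumes "diagonal_contractive d N T" "d \<ge> 1"
  shows "fiber_ifs N T b 0 u = (\<lambda>k x. T k 0 * x + b k 0) ` {..<N}"
proof (intro equalityI subsetI)
  fix h assume "h \<in> fiber_ifs N T b 0 u"
  then obtain k where k: "k < N" "join_map 0 u h = diag_affine (Suc 0) (T k) (b k)"
    by (auto simp: fiber_ifs_def projected_ifs_def)
  have "h y = T k 0 * y + b k 0" for y
    using fun_cong[OF fun_cong[OF k(2), of "\<lambda>_. y"], of 0]
    by (simp add: join_map_def diag_affine_def)
  with k(1) show "h \<in> (\<lambda>k x. T k 0 * x + b k 0) ` {..<N}" by blast
next
  fix h assume "h \<in> (\<lambda>k x. T k 0 * x + b k 0) ` {..<N}"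
  then obtain k where k: "k < N" "h = (\<lambda>x. T k 0 * x + b k 0)" by blast
  have "join_map 0 u h = diag_affine (Suc 0) (T k) (b k)"
    by (auto simp: k(2) join_map_def diag_affine_def fun_eq_iff)
  with k assms show "h \<in> fiber_ifs N T b 0 u"
    by (fastforce simp: fiber_ifs_def projected_ifs_def diagonal_contractive_def)
qed


subsection \<open>Disconnectedness\<close>

definition totally_disconnected_in :: "'a topology \<Rightarrow> 'a set \<Rightarrow> bool" where
  "totally_disconnected_in X S \<longleftrightarrow>
     S \<subseteq> topspace X \<and> (\<forall>C. connectedin X C \<and> C \<subseteq> S \<longrightarrow> (\<exists>a. C \<subseteq> {a}))"

definition delta_sequence ::
    "'a set \<Rightarrow> ('a \<Rightarrow> 'a \<Rightarrow> real) \<Rightarrow> real \<Rightarrow> nat \<Rightarrow> (nat \<Rightarrow> 'a) \<Rightarrow> bool" where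
  "delta_sequence X \<rho> \<delta> n x \<longleftrightarrow>
     n \<ge> 1 \<and> x ` {0..n} \<subseteq> X \<and> inj_on x {0..n} \<and>
     (\<forall>i<n. \<rho> (x i) (x (Suc i)) \<le> \<delta> * \<rho> (x 0) (x n))"

definition uniformly_disconnected :: "'a set \<Rightarrow> ('a \<Rightarrow> 'a \<Rightarrow> real) \<Rightarrow> bool" where
  "uniformly_disconnected X \<rho> \<longleftrightarrow> (\<exists>\<delta>>0. \<not> (\<exists>n x. delta_sequence X \<rho> \<delta> n x))"

end

theory Submission
  imports Defs
begin

text \<open>If a fiber system has attractor \<open>[0,1]\<close>, then \<open>K\<close> contains points over a segment that is parallel
  to a coordinate axis; this segment lies in a projection of \<open>K\<close>, and a high power of one of the maps
  flattens the remaining coordinates, so that equally spaced points become a \<open>\<delta>\<close>-sequence.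

  Conversely, suppose that each fiber system leaves a gap in \<open>[0,1]\<close>. By induction on \<open>l\<close>, a chain in
  \<open>K\<close> whose steps have size at most \<open>r\<close> in the first \<open>l\<close> coordinates moves by at most \<open>C r\<close> in them. For
  the next coordinate, stop the coding words when the cylinders have size about \<open>r\<close>. The chain meets
  only boundedly many cylinders of the projection to the first \<open>l\<close> coordinates, because these are
  disjoint boxes with sides of length at least \<open>c r\<close>. Over each of them the values of the next coordinate
  form a set that is porous at scales above \<open>r\<close>, and a finite union of such sets is again porous.
  Hence a long excursion of the chain would have to jump over a gap of length greater than \<open>r\<close>.\<close>


section \<open>Open sets and segments in the finite-dimensional spaces\<close>

text \<open>For fixed \<open>z\<close> only the finitely many coordinates below \<open>l\<close> are
  constrained, so the set is the trace of a union of open cylinders of the product topology. It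
  supplies the separating sets in \<open>totally_disconnected_if_chain_bound\<close>.\<close>

lemma openin_Euclidean_space_near:
  "openin (Euclidean_space l) {y \<in> topspace (Euclidean_space l). \<exists>z\<in>Z. \<forall>i<l. \<bar>y i - z i\<bar> < e}"
proof -
  have "open (\<Union>z\<in>Z. \<Inter>i\<in>{..<l}. {y::nat \<Rightarrow> real. \<bar>y i - z i\<bar> < e})"
    by (intro open_UN ballI open_INT finite_lessThan open_Collect_less continuous_intros
        continuous_on_product_coordinates)
  moreover have "{y \<in> topspace (Euclidean_space l). \<exists>z\<in>Z. \<forall>i<l. \<bar>y i - z i\<bar> < e} =
    (\<Union>z\<in>Z. \<Inter>i\<in>{..<l}. {y. \<bar>y i - z i\<bar> < e}) \<inter> {y. \<forall>i\<ge>l. y i = 0}"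
    by (auto simp: topspace_Euclidean_space)
  ultimately show ?thesis
    unfolding Euclidean_space_def openin_subtopology euclidean_product_topology
    by (auto simp flip: open_openin)
qed

text \<open>The projection keeps the constant coordinates below \<open>l\<close> and the coordinate
  \<open>l\<close>, which runs through [0,1]. It discards the higher coordinates of
  \<open>x t\<close>, whose dependence on \<open>t\<close> may be discontinuous.\<close>

lemma segment_not_totally_disconnected:
  assumes x: "\<And>t. t \<in> {0..1} \<Longrightarrow> x t \<in> K" "\<And>t. t \<in> {0..1} \<Longrightarrow> x t l = t"
    and const: "\<And>t t' i. t \<in> {0..1} \<Longrightarrow> t' \<in> {0..1} \<Longrightarrow> i < l \<Longrightarrow> x t i = x t' i"
  shows "\<not> totally_disconnected_in (Euclidean_space (Suc l)) (coord_proj (Suc l) ` K)"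
proof
  assume td: "totally_disconnected_in (Euclidean_space (Suc l)) (coord_proj (Suc l) ` K)"
  define f where "f t = (\<lambda>i. if i < l then x 0 i else if i = l then t else 0)" for t :: real
  have f_eq: "f t = coord_proj (Suc l) (x t)" if "t \<in> {0..1}" for t
    using x(2)[OF that] const[OF that, of 0] by (auto simp: f_def coord_proj_def fun_eq_iff less_Suc_eq)
  have "continuous_on {0..1} f"
  proof (rule continuous_on_coordinatewise_then_product)
    show "continuous_on {0..1} (\<lambda>t. f t i)" for i
      by (cases "i < l"; cases "i = l") (auto simp: f_def intro: continuous_on_id)
  qed
  then have "connected (f ` {0..1})" by (rule connected_continuous_image) simp
  then have "connectedin (Euclidean_space (Suc l)) (f ` {0..1})"
    by (auto simp: Euclidean_space_def connectedin_subtopology euclidean_product_topology f_def)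
  moreover have "f ` {0..1} \<subseteq> coord_proj (Suc l) ` K" using x(1) f_eq by auto
  ultimately obtain a where "f ` {0..1} \<subseteq> {a}" using td unfolding totally_disconnected_in_def by blast
  then have "f 0 \<in> {a}" "f 1 \<in> {a}" by (simp_all add: image_subset_iff)
  then have "f 0 l = f 1 l" by simp
  then show False by (simp add: f_def)
qed

section \<open>The Lalley-Gatzouras conditions as inequalities between boxes\<close>

text \<open>Equality of the maps induced on the first \<open>m\<close> coordinates, expressed on
  indices, so that words of indices can replace words of maps. For \<open>m = 0\<close> any two
  indices are related.\<close>

definition same_proj ::
    "(nat \<Rightarrow> nat \<Rightarrow> real) \<Rightarrow> (nat \<Rightarrow> nat \<Rightarrow> real) \<Rightarrow> nat \<Rightarrow> nat \<Rightarrow> nat \<Rightarrow> bool" where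
  "same_proj T b m k k' \<longleftrightarrow> (\<forall>i<m. T k i = T k' i \<and> b k i = b k' i)"

lemma diag_affine_eq_iff:
  "diag_affine m (T k) (b k) = diag_affine m (T k') (b k') \<longleftrightarrow> same_proj T b m k k'"
proof
  assume eq: "diag_affine m (T k) (b k) = diag_affine m (T k') (b k')"
  show "same_proj T b m k k'"
    unfolding same_proj_def
  proof (intro allI impI)
    fix i assume "i < m"
    then show "T k i = T k' i \<and> b k i = b k' i"
      using fun_cong[OF fun_cong[OF eq, of "\<lambda>_. 0"], of i]
        fun_cong[OF fun_cong[OF eq, of "\<lambda>_. 1"], of i]
      by (simp add: diag_affine_def)
  qed
qed (auto simp: same_proj_def diag_affine_def fun_eq_iff)

text \<open>A member of the fiber over the map number \<open>k\<close> comes from an index with the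
  same projection to the first \<open>l\<close> coordinates. Questions about fiber systems thereby
  become questions about indices.\<close>

lemma fiber_ifs_eq:
  assumes "diagonal_contractive d N T" "l < d"
  shows "fiber_ifs N T b l (diag_affine l (T k) (b k)) =
    (\<lambda>k' x. T k' l * x + b k' l) ` {k'. k' < N \<and> same_proj T b l k k'}"
proof (intro equalityI subsetI)
  fix h assume "h \<in> fiber_ifs N T b l (diag_affine l (T k) (b k))"
  then obtain k' where k': "k' < N"
    and eq: "join_map l (diag_affine l (T k) (b k)) h = diag_affine (Suc l) (T k') (b k')"
    by (auto simp: fiber_ifs_def projected_ifs_def)
  have app: "join_map l (diag_affine l (T k) (b k)) h y i = diag_affine (Suc l) (T k') (b k') y i"
    for y i by (simp add: eq)
  have "h y = T k' l * y + b k' l" for y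
    using app[of "\<lambda>_. y" l] by (simp add: join_map_def diag_affine_def)
  moreover have "diag_affine l (T k) (b k) = diag_affine l (T k') (b k')"
  proof (intro ext)
    fix x i show "diag_affine l (T k) (b k) x i = diag_affine l (T k') (b k') x i"
      using app[of x i] by (cases "i < l") (auto simp: join_map_def diag_affine_def coord_proj_def)
  qed
  ultimately show "h \<in> (\<lambda>k' x. T k' l * x + b k' l) ` {k'. k' < N \<and> same_proj T b l k k'}"
    using k' by (auto simp: diag_affine_eq_iff)
next
  fix h assume "h \<in> (\<lambda>k' x. T k' l * x + b k' l) ` {k'. k' < N \<and> same_proj T b l k k'}"
  then obtain k' where k': "k' < N" "same_proj T b l k k'" "h = (\<lambda>x. T k' l * x + b k' l)"
    by blast
  have "join_map l (diag_affine l (T k) (b k)) h = diag_affine (Suc l) (T k') (b k')"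
    using k'(2) by (auto simp: k'(3) join_map_def diag_affine_def coord_proj_def fun_eq_iff
        same_proj_def less_Suc_eq)
  with k' assms show "h \<in> fiber_ifs N T b l (diag_affine l (T k) (b k))"
    by (fastforce simp: fiber_ifs_def projected_ifs_def diagonal_contractive_def)
qed

text \<open>Working form of the hypotheses: the cube conditions become bounds on intervals, and
  disjointness of two open boxes becomes separation in one coordinate.\<close>

locale box_ifs =
  fixes d N :: nat and T b :: "nat \<Rightarrow> nat \<Rightarrow> real"
  assumes T_pos: "\<And>k i. k < N \<Longrightarrow> i < d \<Longrightarrow> 0 < T k i"
    and T_less_1: "\<And>k i. k < N \<Longrightarrow> i < d \<Longrightarrow> T k i < 1"
    and T_decr: "\<And>k i j. k < N \<Longrightarrow> i < j \<Longrightarrow> j < d \<Longrightarrow> T k j < T k i"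
    and b_nonneg: "\<And>k i. k < N \<Longrightarrow> i < d \<Longrightarrow> 0 \<le> b k i"
    and b_T_le_1: "\<And>k i. k < N \<Longrightarrow> i < d \<Longrightarrow> b k i + T k i \<le> 1"
    and box_disjoint: "\<And>k k' m. k < N \<Longrightarrow> k' < N \<Longrightarrow> m \<le> d \<Longrightarrow> \<not> same_proj T b m k k' \<Longrightarrow>
      \<exists>i<m. b k i + T k i \<le> b k' i \<or> b k' i + T k' i \<le> b k i"

text \<open>Let \<open>t\<close> tend to 0 from the right and to 1 from the left.\<close>

lemma affine_unit_interval_bounds:
  fixes a c :: real
  assumes "0 < a" and "\<And>t. 0 < t \<Longrightarrow> t < 1 \<Longrightarrow> 0 < a * t + c \<and> a * t + c < 1"
  shows "0 \<le> c" "c + a \<le> 1"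
proof -
  have lim0: "((\<lambda>t. a * t + c) \<longlongrightarrow> a * 0 + c) (at_right 0)"
    and lim1: "((\<lambda>t. a * t + c) \<longlongrightarrow> a * 1 + c) (at_left 1)"
    by (intro tendsto_intros)+
  have "\<forall>\<^sub>F t in at_right (0::real). 0 \<le> a * t + c"
    using eventually_at_right_less[of 0] eventually_at_right[OF zero_less_one, of "\<lambda>t. t < 1"]
    by (smt (verit, best) assms(2) eventually_at_right_field)
  from tendsto_lowerbound[OF lim0 this] show "0 \<le> c" by simp
  have "\<forall>\<^sub>F t in at_left (1::real). a * t + c \<le> 1"
    using assms(2) by (auto simp: eventually_at_left_field intro!: exI[of _ 0] less_imp_le)
  from tendsto_upperbound[OF lim1 this] show "c + a \<le> 1" by (simp add: add.commute)
qed

text \<open>Two open boxes that overlap in every coordinate have a common point, so disjointness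
  forces separation in some coordinate. The bounds come from the points of the cube with all
  coordinates equal to \<open>t\<close>.\<close>

lemma lalley_gatzouras_box_ifs:
  assumes "lalley_gatzouras d N T b"
  shows "box_ifs d N T b"
proof
  have dc: "diagonal_contractive d N T" and co: "coordinate_ordering d N T"
    and np: "neat_projection d N T b"
    using assms by (auto simp: lalley_gatzouras_def)
  show pos: "0 < T k i" if "k < N" "i < d" for k i
    using dc that by (auto simp: diagonal_contractive_def)
  show "T k i < 1" if "k < N" "i < d" for k i
    using dc that by (auto simp: diagonal_contractive_def)
  show "T k j < T k i" if "k < N" "i < j" "j < d" for k i j
    using that(2,3)
  proof (induction rule: strict_inc_induct)
    case (base i)
    then show ?case using co \<open>k < N\<close> by (auto simp: coordinate_ordering_def)
  next
    case (step i)
    then have "T k (Suc i) < T k i" using co \<open>k < N\<close> by (auto simp: coordinate_ordering_def)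
    with step show ?case by auto
  qed
  have bounds: "0 \<le> b k i \<and> b k i + T k i \<le> 1" if "k < N" "i < d" for k i
  proof -
    have "0 < T k i * t + b k i \<and> T k i * t + b k i < 1" if t: "0 < t" "t < 1" for t
    proof -
      let ?x = "\<lambda>i. if i < d then t else 0"
      have "?x \<in> open_unit_cube d"
        using t by (auto simp: open_unit_cube_def topspace_Euclidean_space)
      moreover have "diag_affine d (T k) (b k) ` open_unit_cube d \<subseteq> open_unit_cube d"
        using np \<open>k < N\<close> \<open>i < d\<close>
        by (force simp: neat_projection_def open_set_condition_with_def projected_ifs_def)
      ultimately have "diag_affine d (T k) (b k) ?x \<in> open_unit_cube d" by blast
      with \<open>i < d\<close> show ?thesis by (auto simp: open_unit_cube_def diag_affine_def)
    qed
    from affine_unit_interval_bounds[OF pos[OF that] this] show ?thesis by simp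
  qed
  show "0 \<le> b k i" "b k i + T k i \<le> 1" if "k < N" "i < d" for k i
    using bounds[OF that] by auto
  show "\<exists>i<m. b k i + T k i \<le> b k' i \<or> b k' i + T k' i \<le> b k i"
    if k: "k < N" "k' < N" and m: "m \<le> d" and neq: "\<not> same_proj T b m k k'" for k k' m
  proof (rule ccontr)
    assume "\<not> ?thesis"
    then have overlap: "b k' i < b k i + T k i" "b k i < b k' i + T k' i" if "i < m" for i
      using that by force+
    \<comment> \<open>Neat projection is assumed from dimension 1 on; in dimension 0 all indices
      have the same projection.\<close>
    have "m \<noteq> 0" using neq by (auto simp: same_proj_def)
    let ?f = "diag_affine m (T k) (b k)" and ?f' = "diag_affine m (T k') (b k')"
    have "?f \<noteq> ?f'" using neq by (simp add: diag_affine_eq_iff)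
    then have disj: "?f ` open_unit_cube m \<inter> ?f' ` open_unit_cube m = {}"
      using np k m \<open>m \<noteq> 0\<close>
      by (auto simp: neat_projection_def open_set_condition_with_def projected_ifs_def
          disjoint_family_on_def)
    have "\<exists>z. b k i < z \<and> b k' i < z \<and> z < b k i + T k i \<and> z < b k' i + T k' i" if "i < m" for i
    proof -
      have "0 < T k i" "0 < T k' i" using pos k m that by auto
      then have "max (b k i) (b k' i) < min (b k i + T k i) (b k' i + T k' i)"
        using overlap[OF that] by auto
      from dense[OF this] show ?thesis by auto
    qed
    then obtain z where z: "\<And>i. i < m \<Longrightarrow> b k i < z i" "\<And>i. i < m \<Longrightarrow> b k' i < z i"
      "\<And>i. i < m \<Longrightarrow> z i < b k i + T k i" "\<And>i. i < m \<Longrightarrow> z i < b k' i + T k' i"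
      by metis
    let ?z = "\<lambda>i. if i < m then z i else 0"
    have "?z \<in> diag_affine m (T q) (b q) ` open_unit_cube m"
      if q: "q < N" "\<And>i. i < m \<Longrightarrow> b q i < z i" "\<And>i. i < m \<Longrightarrow> z i < b q i + T q i" for q
    proof
      let ?x = "\<lambda>i. if i < m then (z i - b q i) / T q i else 0"
      have Tq: "0 < T q i" if "i < m" for i using pos q m that by auto
      show "?z = diag_affine m (T q) (b q) ?x"
        using Tq by (force simp: diag_affine_def fun_eq_iff)
      show "?x \<in> open_unit_cube m"
        using Tq q(2,3) by (auto simp: open_unit_cube_def topspace_Euclidean_space algebra_simps)
    qed
    from this[of k] this[of k'] z k disj show False by blast
  qed
qed

subsection \<open>Coding of points by words\<close>

text \<open>Words are infinite sequences of which only the first \<open>n\<close> letters are read,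
  so prefixes need no type of their own.\<close>

definition width :: "(nat \<Rightarrow> nat \<Rightarrow> real) \<Rightarrow> nat \<Rightarrow> (nat \<Rightarrow> nat) \<Rightarrow> nat \<Rightarrow> real" where
  "width T i \<omega> n = (\<Prod>j<n. T (\<omega> j) i)"

definition corner ::
    "(nat \<Rightarrow> nat \<Rightarrow> real) \<Rightarrow> (nat \<Rightarrow> nat \<Rightarrow> real) \<Rightarrow> nat \<Rightarrow> (nat \<Rightarrow> nat) \<Rightarrow> nat \<Rightarrow> real" where
  "corner T b i \<omega> n = (\<Sum>j<n. width T i \<omega> j * b (\<omega> j) i)"

text \<open>Side \<open>i\<close> of the image of the unit cube under the composition of the maps number
  \<open>\<omega> 0, \<dots>, \<omega> (n - 1)\<close>, the last one being applied first.\<close>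

definition side ::
    "(nat \<Rightarrow> nat \<Rightarrow> real) \<Rightarrow> (nat \<Rightarrow> nat \<Rightarrow> real) \<Rightarrow> nat \<Rightarrow> (nat \<Rightarrow> nat) \<Rightarrow> nat \<Rightarrow> real set" where
  "side T b i \<omega> n = {corner T b i \<omega> n..corner T b i \<omega> n + width T i \<omega> n}"

lemma width_0 [simp]: "width T i \<omega> 0 = 1"
  and width_Suc: "width T i \<omega> (Suc n) = width T i \<omega> n * T (\<omega> n) i"
  and corner_0 [simp]: "corner T b i \<omega> 0 = 0"
  and corner_Suc: "corner T b i \<omega> (Suc n) = corner T b i \<omega> n + width T i \<omega> n * b (\<omega> n) i"
  by (simp_all add: width_def corner_def)

text \<open>Recursion at the outermost map, complementing the recursion at the innermost map in
  \<open>width_Suc\<close>; it serves when a map is applied to a point whose address is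
  known.\<close>

lemma width_Suc_shift: "width T i \<omega> (Suc n) = T (\<omega> 0) i * width T i (\<lambda>j. \<omega> (Suc j)) n"
  by (simp add: width_def prod.lessThan_Suc_shift del: prod.lessThan_Suc)

lemma corner_Suc_shift:
  "corner T b i \<omega> (Suc n) = b (\<omega> 0) i + T (\<omega> 0) i * corner T b i (\<lambda>j. \<omega> (Suc j)) n"
  by (simp add: corner_def sum.lessThan_Suc_shift width_Suc_shift sum_distrib_left mult.assoc
      del: sum.lessThan_Suc)

lemma same_proj_width:
  assumes "\<And>j. j < n \<Longrightarrow> same_proj T b m (\<omega> j) (\<omega>' j)" "i < m"
  shows "width T i \<omega> n = width T i \<omega>' n"
  using assms by (auto simp: width_def same_proj_def intro!: prod.cong)

lemma same_proj_corner:
  assumes "\<And>j. j < n \<Longrightarrow> same_proj T b m (\<omega> j) (\<omega>' j)" "i < m"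
  shows "corner T b i \<omega> n = corner T b i \<omega>' n"
  unfolding corner_def
proof (intro sum.cong refl)
  fix j assume "j \<in> {..<n}"
  then have "width T i \<omega> j = width T i \<omega>' j"
    using assms by (intro same_proj_width[where b = b and m = m]) auto
  then show "width T i \<omega> j * b (\<omega> j) i = width T i \<omega>' j * b (\<omega>' j) i"
    using assms \<open>j \<in> {..<n}\<close> by (auto simp: same_proj_def)
qed

context box_ifs
begin

definition coding :: "(nat \<Rightarrow> nat) \<Rightarrow> bool" where
  "coding \<omega> \<longleftrightarrow> (\<forall>j. \<omega> j < N)"

text \<open>A relation and not a function, because closed boxes may touch and a point may then have
  several addresses.\<close>

definition codes :: "(nat \<Rightarrow> nat) \<Rightarrow> (nat \<Rightarrow> real) \<Rightarrow> bool" where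
  "codes \<omega> x \<longleftrightarrow> coding \<omega> \<and> (\<forall>n. \<forall>i<d. x i \<in> side T b i \<omega> n)"

lemma width_pos: "coding \<omega> \<Longrightarrow> i < d \<Longrightarrow> 0 < width T i \<omega> n"
  using T_pos by (auto simp: width_def coding_def intro!: prod_pos)

lemma side_Suc_subset:
  assumes "coding \<omega>" "i < d"
  shows "side T b i \<omega> (Suc n) \<subseteq> side T b i \<omega> n"
proof -
  have "\<omega> n < N" using assms by (simp add: coding_def)
  have "width T i \<omega> n * (b (\<omega> n) i + T (\<omega> n) i) \<le> width T i \<omega> n * 1"
    using width_pos[OF assms, of n] b_T_le_1[OF \<open>\<omega> n < N\<close> assms(2)]
    by (intro mult_left_mono) auto
  moreover have "0 \<le> width T i \<omega> n * b (\<omega> n) i"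
    using width_pos[OF assms, of n] b_nonneg[OF \<open>\<omega> n < N\<close> assms(2)] by auto
  ultimately show ?thesis
    by (auto simp: side_def width_Suc corner_Suc algebra_simps)
qed

lemma side_antimono:
  assumes "coding \<omega>" "i < d" "m \<le> n"
  shows "side T b i \<omega> n \<subseteq> side T b i \<omega> m"
  using lift_Suc_antimono_le[of "side T b i \<omega>", OF side_Suc_subset[OF assms(1,2)] assms(3)] .

text \<open>Up to the first letter with different projections the two boxes agree in the first
  \<open>m\<close> coordinates. At that letter \<open>box_disjoint\<close> separates them in one
  coordinate, and later letters only shrink the sides.\<close>

lemma side_disjoint:
  assumes \<omega>: "coding \<omega>" "coding \<omega>'" and m: "m \<le> d"
    and neq: "\<not> (\<forall>j<n. same_proj T b m (\<omega> j) (\<omega>' j))"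
  shows "\<exists>i<m. corner T b i \<omega> n + width T i \<omega> n \<le> corner T b i \<omega>' n \<or>
    corner T b i \<omega>' n + width T i \<omega>' n \<le> corner T b i \<omega> n"
proof -
  define j where "j = (LEAST j. \<not> same_proj T b m (\<omega> j) (\<omega>' j))"
  from neq obtain j0 where j0: "j0 < n" "\<not> same_proj T b m (\<omega> j0) (\<omega>' j0)" by blast
  have j: "\<not> same_proj T b m (\<omega> j) (\<omega>' j)" unfolding j_def using LeastI[of "\<lambda>j. \<not> same_proj T b m (\<omega> j) (\<omega>' j)", OF j0(2)] .
  have "j < n" using Least_le[of "\<lambda>j. \<not> same_proj T b m (\<omega> j) (\<omega>' j)", OF j0(2)] j0(1) unfolding j_def by simp
  have eq: "same_proj T b m (\<omega> i) (\<omega>' i)" if "i < j" for i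
    using not_less_Least that unfolding j_def by blast
  obtain i where i: "i < m"
    and disj: "b (\<omega> j) i + T (\<omega> j) i \<le> b (\<omega>' j) i \<or> b (\<omega>' j) i + T (\<omega>' j) i \<le> b (\<omega> j) i"
    using box_disjoint[OF _ _ m j] \<omega> by (auto simp: coding_def)
  have "i < d" using i m by simp
  let ?w = "width T i \<omega> j" and ?c = "corner T b i \<omega> j"
  have w: "width T i \<omega>' j = ?w" and c: "corner T b i \<omega>' j = ?c"
    using same_proj_width[OF eq i] same_proj_corner[OF eq i] by auto
  have "0 < ?w" using width_pos \<omega> \<open>i < d\<close> by blast
  then have "?w * (b (\<omega> j) i + T (\<omega> j) i) \<le> ?w * b (\<omega>' j) i \<or>
    ?w * (b (\<omega>' j) i + T (\<omega>' j) i) \<le> ?w * b (\<omega> j) i"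
    using disj by (simp add: mult_le_cancel_left_pos)
  then have Sucj: "corner T b i \<omega> (Suc j) + width T i \<omega> (Suc j) \<le> corner T b i \<omega>' (Suc j) \<or>
    corner T b i \<omega>' (Suc j) + width T i \<omega>' (Suc j) \<le> corner T b i \<omega> (Suc j)"
    by (simp add: corner_Suc width_Suc w c algebra_simps)
  have "side T b i \<omega> n \<subseteq> side T b i \<omega> (Suc j)" "side T b i \<omega>' n \<subseteq> side T b i \<omega>' (Suc j)"
    using side_antimono \<omega> \<open>i < d\<close> \<open>j < n\<close> by auto
  moreover have "0 < width T i \<omega> n" "0 < width T i \<omega>' n" using width_pos \<omega> \<open>i < d\<close> by auto
  ultimately show ?thesis using Sucj i by (intro exI[of _ i]) (auto simp: side_def)
qed

text \<open>Invariance writes each point of \<open>K\<close> as the image of another point of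
  \<open>K\<close>; iterating this backward choice yields the letters of an address.\<close>

lemma codes_exists:
  assumes inv: "K \<subseteq> (\<Union>f\<in>projected_ifs N T b d. f ` K)" and cube: "K \<subseteq> closed_unit_cube d"
    and x: "x \<in> K"
  obtains \<omega> where "codes \<omega> x"
proof -
  have "\<exists>k y. x \<in> K \<longrightarrow> k < N \<and> y \<in> K \<and> x = diag_affine d (T k) (b k) y" for x
    using inv by (fastforce simp: projected_ifs_def)
  then obtain k y where ky: "\<And>x. x \<in> K \<Longrightarrow> k x < N"  "\<And>x. x \<in> K \<Longrightarrow> y x \<in> K"
    "\<And>x. x \<in> K \<Longrightarrow> x = diag_affine d (T (k x)) (b (k x)) (y x)"
    by metis
  define X where "X n = (y ^^ n) x" for n
  define \<omega> where "\<omega> n = k (X n)" for n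
  have X: "X n \<in> K" for n by (induction n) (auto simp: X_def x ky)
  have coding: "coding \<omega>" by (simp add: coding_def \<omega>_def ky X)
  have X_Suc: "X n i = T (\<omega> n) i * X (Suc n) i + b (\<omega> n) i" if "i < d" for n i
    using fun_cong[OF ky(3)[OF X[of n]], of i] that by (simp add: diag_affine_def \<omega>_def X_def)
  \<comment> \<open>\<open>X n\<close> is the position of \<open>x\<close> in its box of generation
    \<open>n\<close>, rescaled to the unit cube.\<close>
  have x_eq: "x i = corner T b i \<omega> n + width T i \<omega> n * X n i" if "i < d" for n i
  proof (induction n)
    case 0
    then show ?case by (simp add: X_def)
  next
    case (Suc n)
    then show ?case by (simp add: X_Suc[OF that, of n] corner_Suc width_Suc algebra_simps)
  qed
  have "x i \<in> side T b i \<omega> n" if "i < d" for n i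
  proof -
    have "0 \<le> X n i" "X n i \<le> 1" using X[of n] cube that by (auto simp: closed_unit_cube_def)
    with width_pos[OF coding that, of n] show ?thesis
      by (auto simp: side_def x_eq[OF that, of n] mult_le_cancel_left2)
  qed
  with coding that show ?thesis by (auto simp: codes_def)
qed


end

subsection \<open>Porous sets and discrete chains\<close>

text \<open>Porosity with a resolution: below the scale \<open>Q * r\<close> nothing is demanded,
  since gaps shorter than \<open>r\<close> do not stop a chain with steps of size
  \<open>r\<close>.\<close>

definition porous :: "real set \<Rightarrow> real \<Rightarrow> real \<Rightarrow> bool" where
  "porous E r Q \<longleftrightarrow> (\<forall>y L. Q * r \<le> L \<and> L \<le> 1 \<longrightarrow>
     (\<exists>y'\<ge>y. y' + L / Q \<le> y + L \<and> {y'<..<y' + L / Q} \<inter> E = {}))"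

lemma porous_mono:
  assumes "porous E r Q" "1 \<le> Q" "Q \<le> Q'" "0 \<le> r"
  shows "porous E r Q'"
  unfolding porous_def
proof (intro allI impI)
  fix y L assume L: "Q' * r \<le> L \<and> L \<le> 1"
  have "Q * r \<le> Q' * r" using assms by (intro mult_right_mono)
  with L assms(1) obtain y' where y': "y \<le> y'" "y' + L / Q \<le> y + L" "{y'<..<y' + L / Q} \<inter> E = {}"
    unfolding porous_def by (meson order_trans)
  have "0 \<le> Q' * r" using assms by auto
  with L have "0 \<le> L" by linarith
  then have "L / Q' \<le> L / Q" using assms by (intro divide_left_mono) auto
  with y' show "\<exists>y'\<ge>y. y' + L / Q' \<le> y + L \<and> {y'<..<y' + L / Q'} \<inter> E = {}"
    by (intro exI[of _ y']) fastforce
qed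

text \<open>Inside a gap of \<open>A\<close>, of length \<open>L / P\<close>, look for a gap of
  \<open>B\<close>: the scale \<open>L / P\<close> is still at least \<open>Q * r\<close>, and the
  proportions multiply.\<close>

lemma porous_Un:
  assumes "porous A r P" "porous B r Q" "1 \<le> P" "1 \<le> Q" "0 \<le> r"
  shows "porous (A \<union> B) r (P * Q)"
  unfolding porous_def
proof (intro allI impI)
  fix y L assume L: "P * Q * r \<le> L \<and> L \<le> 1"
  have "P * r \<le> P * Q * r" using assms by (intro mult_right_mono) auto
  with L have "P * r \<le> L" by linarith
  then obtain y' where y': "y \<le> y'" "y' + L / P \<le> y + L" "{y'<..<y' + L / P} \<inter> A = {}"
    using assms(1) L unfolding porous_def by blast
  have "0 \<le> P * r" using assms by auto
  with \<open>P * r \<le> L\<close> have "0 \<le> L" by linarith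
  then have "L / P \<le> L / 1" using assms by (intro divide_left_mono) auto
  moreover have "Q * r \<le> L / P" using L assms by (simp add: field_simps)
  ultimately obtain y'' where y'': "y' \<le> y''" "y'' + L / P / Q \<le> y' + L / P"
    "{y''<..<y'' + L / P / Q} \<inter> B = {}"
    using assms(2) L unfolding porous_def by (metis div_by_1 order_trans)
  have "{y''<..<y'' + L / P / Q} \<subseteq> {y'<..<y' + L / P}" using y'' by auto
  with y' y'' have "{y''<..<y'' + L / P / Q} \<inter> (A \<union> B) = {}" by blast
  with y' y'' show "\<exists>y'\<ge>y. y' + L / (P * Q) \<le> y + L \<and> {y'<..<y' + L / (P * Q)} \<inter> (A \<union> B) = {}"
    by (intro exI[of _ y'']) (auto simp: divide_divide_eq_left)
qed

lemma porous_Union: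
  assumes "finite I" "\<And>i. i \<in> I \<Longrightarrow> porous (E i) r Q" "1 \<le> Q" "0 \<le> r"
  shows "porous (\<Union>i\<in>I. E i) r (Q ^ card I)"
  using assms(1,2)
proof (induction I rule: finite_induct)
  case empty
  then show ?case by (auto simp: porous_def)
next
  case (insert i I)
  then have "porous (E i \<union> (\<Union>i\<in>I. E i)) r (Q * Q ^ card I)"
    using assms by (intro porous_Un) auto
  with insert show ?case by simp
qed

text \<open>A step of size at most \<open>r\<close> cannot jump over an interval of length
  \<open>g > r\<close>, so a chain avoiding that interval would stay at or below
  \<open>y\<close>.\<close>

lemma discrete_crossing:
  fixes s :: "nat \<Rightarrow> real"
  assumes "s 0 \<le> y" "y + g \<le> s m" "\<And>j. j < m \<Longrightarrow> \<bar>s j - s (Suc j)\<bar> \<le> r" "r < g" "0 < r"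
  shows "\<exists>j\<le>m. y < s j \<and> s j < y + g"
proof (rule ccontr)
  assume none: "\<not> ?thesis"
  have "s j \<le> y" if "j \<le> m" for j
    using that
  proof (induction j)
    case (Suc j)
    then have "s (Suc j) < y + g" using assms(3)[of j] assms(4) by fastforce
    with none Suc.prems show ?case by fastforce
  qed (use assms in auto)
  from this[of m] assms show False by auto
qed

text \<open>Porosity is applied at the scale \<open>L\<close> of the distance of the end points: if
  \<open>L > Q * r\<close>, there is a gap of length \<open>L / Q > r\<close> between them, which
  the chain would have to jump.\<close>

lemma porous_chain_bound:
  fixes s :: "nat \<Rightarrow> real"
  assumes "porous E r Q" "1 \<le> Q" "0 < r" "\<bar>s 0 - s m\<bar> \<le> 1"
    and E: "\<And>j. j \<le> m \<Longrightarrow> s j \<in> E"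
    and step: "\<And>j. j < m \<Longrightarrow> \<bar>s j - s (Suc j)\<bar> \<le> r"
  shows "\<bar>s 0 - s m\<bar> \<le> Q * r"
proof (rule ccontr)
  define L where "L = \<bar>s 0 - s m\<bar>"
  assume "\<not> ?thesis"
  then have L: "Q * r < L" by (simp add: L_def)
  then obtain y where y: "min (s 0) (s m) \<le> y" "y + L / Q \<le> min (s 0) (s m) + L"
    "{y<..<y + L / Q} \<inter> E = {}"
    using assms(1,4) unfolding porous_def L_def by (meson less_imp_le)
  have g: "r < L / Q" using L \<open>1 \<le> Q\<close> by (simp add: field_simps)
  have "\<exists>j\<le>m. y < s j \<and> s j < y + L / Q"
  proof (cases "s 0 \<le> s m")
    case True
    then show ?thesis using y step g \<open>0 < r\<close> by (intro discrete_crossing[where r = r]) (auto simp: L_def)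
  next
    case False
    \<comment> \<open>A descending chain is reflected at 0 to become an ascending one.\<close>
    have "\<exists>j\<le>m. -(y + L / Q) < - s j \<and> - s j < -(y + L / Q) + L / Q"
      using False y step g \<open>0 < r\<close>
      by (intro discrete_crossing[where r = r]) (force simp: L_def)+
    then show ?thesis by force
  qed
  with y(3) E show False by fastforce
qed

text \<open>The next grid point to the right of \<open>x\<close> serves if it stays in the interval,
  otherwise the next one to the left; \<open>3 * h \<le> w\<close> leaves room on one side.\<close>

lemma grid_point_exists:
  fixes p w x h :: real
  assumes "0 < h" "3 * h \<le> w" "p \<le> x" "x \<le> p + w"
  shows "\<exists>z::int. p < h * z \<and> h * z < p + w \<and> \<bar>z - x / h\<bar> \<le> 1"
proof (cases "x + h < p + w")
  case True
  define z where "z = \<lfloor>x / h\<rfloor> + 1"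
  have z: "x / h < z" "z \<le> x / h + 1" unfolding z_def by linarith+
  then have "x < h * z" "h * z \<le> x + h" using assms by (auto simp: field_simps)
  with True assms z show ?thesis by (intro exI[of _ z]) auto
next
  case False
  define z where "z = \<lceil>x / h\<rceil> - 1"
  have z: "z < x / h" "x / h - 1 \<le> z" unfolding z_def by linarith+
  then have "h * z < x" "x - h \<le> h * z" using assms by (auto simp: field_simps)
  with False assms z show ?thesis by (intro exI[of _ z]) auto
qed

text \<open>The count does not depend on \<open>a\<close>, which makes the later bound on the number
  of cells uniform over all positions.\<close>

lemma card_ints_near:
  fixes a B :: real
  shows "finite {z::int. \<bar>z - a\<bar> \<le> B}" "card {z::int. \<bar>z - a\<bar> \<le> B} \<le> nat (\<lceil>2 * B\<rceil> + 1)"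
proof -
  have sub: "{z::int. \<bar>z - a\<bar> \<le> B} \<subseteq> {\<lceil>a - B\<rceil>..\<lfloor>a + B\<rfloor>}"
    by (auto simp: ceiling_le_iff le_floor_iff abs_le_iff)
  then show "finite {z::int. \<bar>z - a\<bar> \<le> B}" by (rule finite_subset) simp
  have "card {z::int. \<bar>z - a\<bar> \<le> B} \<le> card {\<lceil>a - B\<rceil>..\<lfloor>a + B\<rfloor>}"
    by (intro card_mono sub) simp
  also have "\<dots> \<le> nat (\<lceil>2 * B\<rceil> + 1)" unfolding card_atLeastAtMost_int by (intro nat_mono) linarith
  finally show "card {z::int. \<bar>z - a\<bar> \<le> B} \<le> nat (\<lceil>2 * B\<rceil> + 1)" .
qed

section \<open>Gaps in fibers, stopping times and cells\<close>

context box_ifs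
begin

text \<open>The position \<open>\<alpha>\<close> of the gap may vary with the fiber, its length
  \<open>\<epsilon>\<close> may not.\<close>

definition fiber_gap :: "nat \<Rightarrow> real \<Rightarrow> bool" where
  "fiber_gap l \<epsilon> \<longleftrightarrow> (\<forall>k<N. \<exists>\<alpha>\<ge>0. \<alpha> + \<epsilon> \<le> 1 \<and>
     (\<forall>k'<N. same_proj T b l k k' \<longrightarrow> b k' l + T k' l \<le> \<alpha> \<or> \<alpha> + \<epsilon> \<le> b k' l))"

text \<open>This ratio depends only on the projection of the map number \<open>k\<close> to the first \<open>l\<close>
  coordinates and lies between its ratios in the coordinates \<open>l\<close> and \<open>l - 1\<close>. Stopping times based
  on it therefore see only the projected words, also for \<open>l = 0\<close>.\<close>

definition fiber_ratio :: "nat \<Rightarrow> nat \<Rightarrow> real" where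
  "fiber_ratio l k = Max ((\<lambda>k'. T k' l) ` {k'. k' < N \<and> same_proj T b l k k'})"

definition fiber_width :: "nat \<Rightarrow> (nat \<Rightarrow> nat) \<Rightarrow> nat \<Rightarrow> real" where
  "fiber_width l \<omega> n = (\<Prod>j<n. fiber_ratio l (\<omega> j))"

definition stop :: "nat \<Rightarrow> real \<Rightarrow> (nat \<Rightarrow> nat) \<Rightarrow> nat" where
  "stop l r \<omega> = (LEAST n. fiber_width l \<omega> n \<le> r)"

text \<open>A cell collects the words whose stopped prefixes give the same word of projected
  maps.\<close>

definition same_cell :: "nat \<Rightarrow> real \<Rightarrow> (nat \<Rightarrow> nat) \<Rightarrow> (nat \<Rightarrow> nat) \<Rightarrow> bool" where
  "same_cell l r \<omega> \<omega>' \<longleftrightarrow>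
     stop l r \<omega> = stop l r \<omega>' \<and> (\<forall>j<stop l r \<omega>. same_proj T b l (\<omega> j) (\<omega>' j))"

lemma same_proj_refl [simp]: "same_proj T b m k k"
  by (simp add: same_proj_def)

lemma same_proj_sym: "same_proj T b m k k' \<Longrightarrow> same_proj T b m k' k"
  by (simp add: same_proj_def)

lemma same_proj_trans: "same_proj T b m k k' \<Longrightarrow> same_proj T b m k' k'' \<Longrightarrow> same_proj T b m k k''"
  by (simp add: same_proj_def)

lemma fiber_ratio_attained:
  assumes "k < N"
  obtains k' where "k' < N" "same_proj T b l k k'" "fiber_ratio l k = T k' l"
proof -
  have "fiber_ratio l k \<in> (\<lambda>k'. T k' l) ` {k'. k' < N \<and> same_proj T b l k k'}"
    unfolding fiber_ratio_def using assms by (intro Max_in) auto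
  with that show ?thesis by auto
qed

lemma fiber_ratio_ge: "k < N \<Longrightarrow> T k l \<le> fiber_ratio l k"
  unfolding fiber_ratio_def by (rule Max_ge) auto

text \<open>The maximizing index shares the ratio in coordinate \<open>i\<close> with
  \<open>k\<close>, so the coordinate ordering for that index gives the comparison.\<close>

lemma fiber_ratio_le:
  assumes "k < N" "i < l" "l < d"
  shows "fiber_ratio l k \<le> T k i"
proof -
  obtain k' where k': "k' < N" "same_proj T b l k k'" "fiber_ratio l k = T k' l"
    using fiber_ratio_attained[OF assms(1)] .
  have "T k i = T k' i" using k'(2) assms(2) by (simp add: same_proj_def)
  with T_decr[OF k'(1) assms(2,3)] k'(3) show ?thesis by simp
qed

lemma fiber_ratio_cong:
  assumes "same_proj T b l k k'"
  shows "fiber_ratio l k = fiber_ratio l k'"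
proof -
  have "same_proj T b l k = same_proj T b l k'"
    using assms by (auto simp: same_proj_def fun_eq_iff)
  then show ?thesis by (simp add: fiber_ratio_def)
qed

lemma ratio_lower_bound:
  assumes "l < d"
  obtains c where "0 < c" "c \<le> 1" "\<And>k. k < N \<Longrightarrow> c \<le> T k l"
proof
  \<comment> \<open>Inserting 1 covers the case \<open>N = 0\<close> and yields the bound by
    1.\<close>
  let ?A = "insert 1 ((\<lambda>k. T k l) ` {..<N})"
  show "0 < Min ?A" using T_pos assms by (subst Min_gr_iff) auto
  show "Min ?A \<le> 1" by (rule Min_le) auto
  show "Min ?A \<le> T k l" if "k < N" for k by (rule Min_le) (use that in auto)
qed

lemma ratio_upper_bound:
  assumes "l < d"
  obtains q where "0 \<le> q" "q < 1" "\<And>k. k < N \<Longrightarrow> T k l \<le> q"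
proof
  let ?A = "insert 0 ((\<lambda>k. T k l) ` {..<N})"
  show "Max ?A < 1" using T_less_1 assms by (subst Max_less_iff) auto
  show "0 \<le> Max ?A" by (rule Max_ge) auto
  show "T k l \<le> Max ?A" if "k < N" for k by (rule Max_ge) (use that in auto)
qed

lemma width_tendsto_0:
  assumes "coding \<omega>" "l < d"
  shows "(\<lambda>n. width T l \<omega> n) \<longlonglongrightarrow> 0"
proof -
  obtain q where q: "0 \<le> q" "q < 1" "\<And>k. k < N \<Longrightarrow> T k l \<le> q"
    using ratio_upper_bound[OF assms(2)] by blast
  have "width T l \<omega> n \<le> q ^ n" for n
  proof -
    have "(\<Prod>j<n. T (\<omega> j) l) \<le> (\<Prod>j<n. q)"
      using assms q T_pos by (intro prod_mono) (auto simp: coding_def intro: less_imp_le)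
    then show ?thesis by (simp add: width_def)
  qed
  moreover have "0 \<le> width T l \<omega> n" for n using width_pos[OF assms] by (simp add: less_imp_le)
  moreover have "(\<lambda>n. q ^ n) \<longlonglongrightarrow> 0" using q by (intro LIMSEQ_power_zero) auto
  ultimately show ?thesis
    using tendsto_sandwich[of "\<lambda>_. 0" "width T l \<omega>" sequentially "\<lambda>n. q ^ n" 0] by simp
qed

text \<open>Replacing each letter by a maximizing index of its fiber turns the product into an
  ordinary width, so that the decay of widths applies to it.\<close>

lemma fiber_width_eq_width:
  assumes "coding \<omega>" "l < d"
  obtains \<omega>' where "coding \<omega>'" "fiber_width l \<omega> = width T l \<omega>'"
proof -
  have "\<exists>k'. k' < N \<and> fiber_ratio l (\<omega> j) = T k' l" for j
  proof -
    have "\<omega> j < N" using assms by (simp add: coding_def)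
    from fiber_ratio_attained[OF this, of l] show ?thesis by blast
  qed
  then obtain \<omega>' where "\<And>j. \<omega>' j < N \<and> fiber_ratio l (\<omega> j) = T (\<omega>' j) l" by metis
  with that[of \<omega>'] show ?thesis by (auto simp: coding_def fiber_width_def width_def fun_eq_iff)
qed

lemma stop_exists:
  assumes "coding \<omega>" "l < d" "0 < r"
  shows "\<exists>n. fiber_width l \<omega> n \<le> r"
proof -
  obtain \<omega>' where \<omega>': "coding \<omega>'" "fiber_width l \<omega> = width T l \<omega>'"
    using fiber_width_eq_width[OF assms(1,2)] .
  from width_tendsto_0[OF \<omega>'(1) assms(2)] have "\<forall>\<^sub>F n in sequentially. width T l \<omega>' n < r"
    using \<open>0 < r\<close> by (rule order_tendstoD)
  then show ?thesis unfolding \<omega>' eventually_sequentially by (meson order_refl less_imp_le)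
qed

lemma fiber_width_stop_le:
  "coding \<omega> \<Longrightarrow> l < d \<Longrightarrow> 0 < r \<Longrightarrow> fiber_width l \<omega> (stop l r \<omega>) \<le> r"
  unfolding stop_def by (rule LeastI_ex[of "\<lambda>n. fiber_width l \<omega> n \<le> r"]) (rule stop_exists)

text \<open>One letter before stopping the product still exceeds \<open>r\<close>, and the last
  factor is at least \<open>c\<close>. There is such a letter because the empty product 1 exceeds
  \<open>r\<close>.\<close>

lemma fiber_width_stop_ge:
  assumes \<omega>: "coding \<omega>" and l: "l < d" and r: "0 < r" "r < 1"
    and c: "0 < c" "\<And>k. k < N \<Longrightarrow> c \<le> T k l"
  shows "c * r \<le> fiber_width l \<omega> (stop l r \<omega>)"
proof -
  have "stop l r \<omega> \<noteq> 0"
  proof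
    assume "stop l r \<omega> = 0"
    then have "fiber_width l \<omega> 0 \<le> r" using fiber_width_stop_le[OF \<omega> l r(1)] by simp
    then show False using r by (simp add: fiber_width_def)
  qed
  then obtain n where n: "stop l r \<omega> = Suc n" by (cases "stop l r \<omega>") auto
  then have "r < fiber_width l \<omega> n"
    using not_less_Least[of n "\<lambda>n. fiber_width l \<omega> n \<le> r"] by (simp add: stop_def)
  moreover have "c \<le> fiber_ratio l (\<omega> n)"
    using c(2) fiber_ratio_ge[of "\<omega> n" l] \<omega> by (meson coding_def order_trans)
  ultimately have "r * c \<le> fiber_width l \<omega> n * fiber_ratio l (\<omega> n)"
    using c r by (intro mult_mono) auto
  then show ?thesis by (simp add: n fiber_width_def mult.commute)
qed

text \<open>Together with \<open>fiber_width_le_width\<close> this controls boxes at the stopping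
  time: side \<open>l\<close> has length at most \<open>r\<close>, the sides below \<open>l\<close>
  have length at least \<open>c * r\<close>.\<close>

lemma width_le_fiber_width:
  assumes "coding \<omega>" "l < d"
  shows "width T l \<omega> n \<le> fiber_width l \<omega> n"
  unfolding width_def fiber_width_def using assms fiber_ratio_ge T_pos
  by (intro prod_mono) (auto simp: coding_def intro: less_imp_le)

lemma fiber_width_le_width:
  assumes "coding \<omega>" "l < d" "i < l"
  shows "fiber_width l \<omega> n \<le> width T i \<omega> n"
  unfolding width_def fiber_width_def
proof (intro prod_mono conjI)
  fix j
  have "\<omega> j < N" using assms by (simp add: coding_def)
  then show "0 \<le> fiber_ratio l (\<omega> j)" "fiber_ratio l (\<omega> j) \<le> T (\<omega> j) i"
    using T_pos[of "\<omega> j" l] fiber_ratio_ge[of "\<omega> j" l] fiber_ratio_le assms by auto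
qed

lemma fiber_width_cong:
  assumes "\<And>j. j < n \<Longrightarrow> same_proj T b l (\<omega> j) (\<omega>' j)"
  shows "fiber_width l \<omega> n = fiber_width l \<omega>' n"
  unfolding fiber_width_def using assms by (intro prod.cong) (auto intro: fiber_ratio_cong)

text \<open>A common interior point contradicts \<open>side_disjoint\<close>, so the projections
  agree up to the earlier stopping time. Then the fiber widths agree there too, and the other word
  stops no later.\<close>

lemma same_cellI:
  assumes \<omega>: "coding \<omega>" "coding \<omega>'" and l: "l < d" and r: "0 < r"
    and le: "stop l r \<omega> \<le> stop l r \<omega>'"
    and common: "\<And>i. i < l \<Longrightarrow>
      corner T b i \<omega> (stop l r \<omega>) < z i \<and>
      z i < corner T b i \<omega> (stop l r \<omega>) + width T i \<omega> (stop l r \<omega>) \<and>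
      corner T b i \<omega>' (stop l r \<omega>') < z i \<and>
      z i < corner T b i \<omega>' (stop l r \<omega>') + width T i \<omega>' (stop l r \<omega>')"
  shows "same_cell l r \<omega> \<omega>'"
proof -
  let ?n = "stop l r \<omega>"
  have same: "\<forall>j<?n. same_proj T b l (\<omega> j) (\<omega>' j)"
  proof (rule ccontr)
    assume "\<not> ?thesis"
    from side_disjoint[OF \<omega> _ this] l obtain i where i: "i < l" and
      disj: "corner T b i \<omega> ?n + width T i \<omega> ?n \<le> corner T b i \<omega>' ?n \<or>
        corner T b i \<omega>' ?n + width T i \<omega>' ?n \<le> corner T b i \<omega> ?n" by auto
    have "side T b i \<omega>' (stop l r \<omega>') \<subseteq> side T b i \<omega>' ?n"
      using side_antimono \<omega> i l le by auto
    moreover have "0 < width T i \<omega>' (stop l r \<omega>')" using width_pos \<omega> i l by auto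
    ultimately show False using disj common[OF i] by (auto simp: side_def)
  qed
  then have "fiber_width l \<omega>' ?n \<le> r"
    using fiber_width_cong[of ?n l \<omega> \<omega>'] fiber_width_stop_le[OF \<omega>(1) l r] by auto
  then have "stop l r \<omega>' \<le> ?n" by (simp add: stop_def Least_le)
  with le same show ?thesis by (simp add: same_cell_def)
qed

lemma same_cell_sym: "same_cell l r \<omega> \<omega>' \<Longrightarrow> same_cell l r \<omega>' \<omega>"
  by (auto simp: same_cell_def intro: same_proj_sym)

lemma same_cell_trans:
  "same_cell l r \<omega> \<omega>' \<Longrightarrow> same_cell l r \<omega>' \<omega>'' \<Longrightarrow> same_cell l r \<omega> \<omega>''"
  unfolding same_cell_def by (metis same_proj_trans)

text \<open>Distinct cells are disjoint boxes with all sides of length at least \<open>c r\<close>, so each of them can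
  be labelled by a point of a grid of mesh \<open>c r / 3\<close> in its interior and close to \<open>a\<close>.\<close>

lemma card_cells_near:
  assumes l: "l < d" and C: "0 \<le> C"
  obtains M :: nat where "\<And>r a \<Omega>. \<lbrakk>0 < r; r < 1;
      \<And>\<omega>. \<omega> \<in> \<Omega> \<Longrightarrow> \<exists>x. codes \<omega> x \<and> (\<forall>i<l. \<bar>x i - a i\<bar> \<le> C * r)\<rbrakk> \<Longrightarrow>
    \<exists>R\<subseteq>\<Omega>. finite R \<and> card R \<le> M \<and> (\<forall>\<omega>\<in>\<Omega>. \<exists>\<omega>'\<in>R. same_cell l r \<omega>' \<omega>)"
proof -
  obtain c where c: "0 < c" "c \<le> 1" "\<And>k. k < N \<Longrightarrow> c \<le> T k l"
    using ratio_lower_bound[OF l] by blast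
  \<comment> \<open>The chosen grid point is within one mesh of \<open>x i\<close>, and
    \<open>C * r\<close> amounts to \<open>3 * C / c\<close> meshes of size
    \<open>c * r / 3\<close>.\<close>
  define B where "B = 1 + 3 * C / c"
  define M where "M = nat (\<lceil>2 * B\<rceil> + 1) ^ l"
  show ?thesis
  proof (rule that[of M])
    fix r :: real and a :: "nat \<Rightarrow> real" and \<Omega> :: "(nat \<Rightarrow> nat) set"
    assume r: "0 < r" "r < 1"
      and near: "\<And>\<omega>. \<omega> \<in> \<Omega> \<Longrightarrow> \<exists>x. codes \<omega> x \<and> (\<forall>i<l. \<bar>x i - a i\<bar> \<le> C * r)"
    define h where "h = c * r / 3"
    have h: "0 < h" using c r by (simp add: h_def)
    define G where "G = (\<Pi>\<^sub>E i\<in>{..<l}. {z::int. \<bar>z - a i / h\<bar> \<le> B})"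
    have finG: "finite G" unfolding G_def by (intro finite_PiE card_ints_near) auto
    have "card G = (\<Prod>i<l. card {z::int. \<bar>z - a i / h\<bar> \<le> B})"
      unfolding G_def by (rule card_PiE) simp
    also have "\<dots> \<le> (\<Prod>i<l. nat (\<lceil>2 * B\<rceil> + 1))" by (intro prod_mono) (auto intro: card_ints_near)
    finally have cardG: "card G \<le> M" by (simp add: M_def)
    define inside where "inside \<omega> g \<longleftrightarrow> (\<forall>i<l. corner T b i \<omega> (stop l r \<omega>) < h * of_int (g i) \<and>
        h * of_int (g i) < corner T b i \<omega> (stop l r \<omega>) + width T i \<omega> (stop l r \<omega>))"
      for \<omega> and g :: "nat \<Rightarrow> int"
    have "\<forall>\<omega>\<in>\<Omega>. \<exists>g. g \<in> G \<and> inside \<omega> g"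
    proof
      fix \<omega> assume \<omega>: "\<omega> \<in> \<Omega>"
      obtain x where x: "codes \<omega> x" "\<And>i. i < l \<Longrightarrow> \<bar>x i - a i\<bar> \<le> C * r"
        using near[OF \<omega>] by blast
      have "\<forall>i\<in>{..<l}. \<exists>z::int. corner T b i \<omega> (stop l r \<omega>) < h * z \<and>
        h * z < corner T b i \<omega> (stop l r \<omega>) + width T i \<omega> (stop l r \<omega>) \<and> \<bar>z - a i / h\<bar> \<le> B"
      proof
        fix i assume "i \<in> {..<l}"
        then have i: "i < l" by simp
        have cod: "coding \<omega>" using x by (simp add: codes_def)
        have "c * r \<le> width T i \<omega> (stop l r \<omega>)"
          using fiber_width_stop_ge[OF cod l r c(1,3)] fiber_width_le_width[OF cod l i] order_trans
          by blast
        then have w: "3 * h \<le> width T i \<omega> (stop l r \<omega>)" by (simp add: h_def)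
        have "x i \<in> side T b i \<omega> (stop l r \<omega>)" using x i l by (simp add: codes_def)
        then obtain z :: int where z: "corner T b i \<omega> (stop l r \<omega>) < h * z"
          "h * z < corner T b i \<omega> (stop l r \<omega>) + width T i \<omega> (stop l r \<omega>)" "\<bar>z - x i / h\<bar> \<le> 1"
          using grid_point_exists[OF h w, of _ "x i"] unfolding side_def atLeastAtMost_iff by metis
        have "\<bar>x i / h - a i / h\<bar> = \<bar>x i - a i\<bar> / h"
          using h by (simp flip: diff_divide_distrib add: abs_divide)
        also have "\<dots> \<le> C * r / h" using x(2)[OF i] h by (intro divide_right_mono) auto
        also have "\<dots> = 3 * C / c" using r by (simp add: h_def)
        finally show "\<exists>z::int. corner T b i \<omega> (stop l r \<omega>) < h * z \<and>
            h * z < corner T b i \<omega> (stop l r \<omega>) + width T i \<omega> (stop l r \<omega>) \<and> \<bar>z - a i / h\<bar> \<le> B"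
          using z by (intro exI[of _ z]) (auto simp: B_def)
      qed
      from bchoice[OF this] obtain g :: "nat \<Rightarrow> int" where
        g: "\<forall>i\<in>{..<l}. corner T b i \<omega> (stop l r \<omega>) < h * of_int (g i) \<and>
          h * of_int (g i) < corner T b i \<omega> (stop l r \<omega>) + width T i \<omega> (stop l r \<omega>) \<and>
          \<bar>of_int (g i) - a i / h\<bar> \<le> B" ..
      \<comment> \<open>\<open>restrict\<close> makes the label extensional, as membership in the
        product \<open>G\<close> requires.\<close>
      then show "\<exists>g. g \<in> G \<and> inside \<omega> g"
        by (intro exI[of _ "restrict g {..<l}"]) (auto simp: G_def inside_def)
    qed
    from bchoice[OF this] obtain g where g: "\<forall>\<omega>\<in>\<Omega>. g \<omega> \<in> G \<and> inside \<omega> (g \<omega>)" ..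
    have cell: "same_cell l r \<omega> \<omega>'" if \<omega>: "\<omega> \<in> \<Omega>" "\<omega>' \<in> \<Omega>" "g \<omega> = g \<omega>'" for \<omega> \<omega>'
    proof -
      have cod: "coding \<omega>" "coding \<omega>'" using near[OF \<omega>(1)] near[OF \<omega>(2)] by (auto simp: codes_def)
      have in1: "inside \<omega> (g \<omega>)" using g \<omega>(1) by blast
      have in2: "inside \<omega>' (g \<omega>)" using g \<omega>(2) unfolding \<omega>(3) by blast
      show ?thesis
      proof (cases "stop l r \<omega> \<le> stop l r \<omega>'")
        case True
        show ?thesis
          by (rule same_cellI[OF cod l r(1) True, of "\<lambda>i. h * of_int (g \<omega> i)"])
            (use in1 in2 in \<open>simp add: inside_def\<close>)
      next
        case False
        then have le: "stop l r \<omega>' \<le> stop l r \<omega>" by simp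
        have "same_cell l r \<omega>' \<omega>"
          by (rule same_cellI[OF cod(2,1) l r(1) le, of "\<lambda>i. h * of_int (g \<omega> i)"])
            (use in1 in2 in \<open>simp add: inside_def\<close>)
        then show ?thesis by (rule same_cell_sym)
      qed
    qed
    \<comment> \<open>One representative for each label that occurs; equal labels force equal
      cells.\<close>
    let ?R = "inv_into \<Omega> g ` g ` \<Omega>"
    have sub: "g ` \<Omega> \<subseteq> G" using g by blast
    show "\<exists>R\<subseteq>\<Omega>. finite R \<and> card R \<le> M \<and> (\<forall>\<omega>\<in>\<Omega>. \<exists>\<omega>'\<in>R. same_cell l r \<omega>' \<omega>)"
    proof (intro exI[of _ ?R] conjI ballI)
      show "?R \<subseteq> \<Omega>" by (auto intro: inv_into_into)
      have "finite (g ` \<Omega>)" using sub finG by (rule finite_subset)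
      then show "finite ?R" by (rule finite_imageI)
      have "card ?R \<le> card (g ` \<Omega>)" by (rule card_image_le) fact
      also have "\<dots> \<le> card G" by (rule card_mono[OF finG sub])
      finally show "card ?R \<le> M" using cardG by simp
      fix \<omega> assume \<omega>: "\<omega> \<in> \<Omega>"
      let ?\<omega>' = "inv_into \<Omega> g (g \<omega>)"
      have "?\<omega>' \<in> \<Omega>" using \<omega> by (auto intro: inv_into_into)
      moreover have "g ?\<omega>' = g \<omega>" by (rule f_inv_into_f[of "g \<omega>" g \<Omega>]) (use \<omega> in blast)
      ultimately have "same_cell l r ?\<omega>' \<omega>" using \<omega> cell by blast
      then show "\<exists>\<omega>'\<in>?R. same_cell l r \<omega>' \<omega>" using \<omega> by blast
    qed
  qed
qed

section \<open>Porosity of the fiber over a cell\<close>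

text \<open>Contains coordinate \<open>l\<close> of every point that has an address in the cell of
  \<open>\<omega>\<close>.\<close>

definition fiber_cover :: "nat \<Rightarrow> real \<Rightarrow> (nat \<Rightarrow> nat) \<Rightarrow> real set" where
  "fiber_cover l r \<omega> = (\<Union>\<omega>'\<in>{\<omega>'. coding \<omega>' \<and> same_cell l r \<omega> \<omega>'}. side T b l \<omega>' (stop l r \<omega>'))"

text \<open>If the cover meets the middle third of an interval of length \<open>L\<close>, pass from
  the box of such a point to its first ancestor whose side \<open>l\<close> is at most
  \<open>L / 3\<close>. This side lies inside the interval, and the gap of its fiber, scaled by its
  width, is missed by the whole cover.\<close>

lemma porous_fiber_cover:
  assumes l: "l < d" and gap: "fiber_gap l \<epsilon>" and \<epsilon>: "0 < \<epsilon>"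
    and c: "0 < c" "c \<le> 1" "\<And>k. k < N \<Longrightarrow> c \<le> T k l"
    and \<omega>0: "coding \<omega>0" and r: "0 < r"
  shows "porous (fiber_cover l r \<omega>0) r (4 / (c * \<epsilon>))"
  unfolding porous_def
proof (intro allI impI)
  let ?Q = "4 / (c * \<epsilon>)"
  fix y L assume L: "?Q * r \<le> L \<and> L \<le> 1"
  have "\<omega>0 0 < N" using \<omega>0 by (simp add: coding_def)
  then have "\<epsilon> \<le> 1" using gap unfolding fiber_gap_def by force
  have "0 < ?Q * r" using c \<epsilon> r by auto
  with L have "0 < L" by linarith
  define e where "e = c * \<epsilon> * L"
  have LQ: "L / ?Q = e / 4" by (simp add: e_def)
  have c\<epsilon>: "c * \<epsilon> \<le> 1" "c * \<epsilon> \<le> c" using c \<epsilon> \<open>\<epsilon> \<le> 1\<close> by (auto simp: mult_le_one)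
  have "4 * r \<le> e" using L c \<epsilon> by (simp add: e_def field_simps)
  also have e_le: "e \<le> c * L" unfolding e_def using \<open>0 < L\<close> c\<epsilon> by (intro mult_right_mono) auto
  finally have r_le: "4 * r \<le> c * L" .
  have "c * L \<le> L" using c(2) \<open>0 < L\<close> by simp
  then have cL: "e \<le> L" using e_le by linarith
  have "0 < e" using c \<epsilon> \<open>0 < L\<close> by (simp add: e_def)
  show "\<exists>y'\<ge>y. y' + L / ?Q \<le> y + L \<and> {y'<..<y' + L / ?Q} \<inter> fiber_cover l r \<omega>0 = {}"
  proof (cases "{y + L / 3<..<y + 2 * L / 3} \<inter> fiber_cover l r \<omega>0 = {}")
    case True
    moreover have "{y + L / 3<..<y + L / 3 + L / ?Q} \<subseteq> {y + L / 3<..<y + 2 * L / 3}"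
      using cL \<open>0 < L\<close> unfolding LQ by auto
    ultimately show ?thesis using cL \<open>0 < L\<close> unfolding LQ by (intro exI[of _ "y + L / 3"]) auto
  next
    case False
    then obtain z \<omega> where z: "y + L / 3 < z" "z < y + 2 * L / 3"
      and \<omega>: "coding \<omega>" "same_cell l r \<omega>0 \<omega>" and z_side: "z \<in> side T b l \<omega> (stop l r \<omega>)"
      by (auto simp: fiber_cover_def)
    let ?n = "stop l r \<omega>"
    have wn: "width T l \<omega> ?n \<le> r"
      by (rule order_trans[OF width_le_fiber_width[OF \<omega>(1) l] fiber_width_stop_le[OF \<omega>(1) l r]])
    have "r \<le> L / 3" using r_le \<open>c * L \<le> L\<close> \<open>0 < L\<close> by linarith
    \<comment> \<open>The coarsest generation that fits; its width lies between
      \<open>c * L / 3\<close> and \<open>L / 3\<close>.\<close>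
    define j where "j = (LEAST j. width T l \<omega> j \<le> L / 3)"
    have wj: "width T l \<omega> j \<le> L / 3" unfolding j_def
      by (rule LeastI[of "\<lambda>j. width T l \<omega> j \<le> L / 3" ?n]) (use wn \<open>r \<le> L / 3\<close> in linarith)
    have "j \<le> ?n" unfolding j_def by (rule Least_le) (use wn \<open>r \<le> L / 3\<close> in linarith)
    have wj_ge: "c * L / 3 \<le> width T l \<omega> j"
    proof (cases j)
      \<comment> \<open>Impossible: the empty word has width 1, while
        \<open>L \<le> 1\<close>.\<close>
      case 0
      then show ?thesis using wj L by simp
    next
      case (Suc i)
      then have "L / 3 < width T l \<omega> i"
        using not_less_Least[of i "\<lambda>j. width T l \<omega> j \<le> L / 3"] unfolding j_def by simp
      moreover have "c \<le> T (\<omega> i) l" using c(3) \<omega>(1) by (simp add: coding_def)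
      ultimately have "L / 3 * c \<le> width T l \<omega> i * T (\<omega> i) l"
        using c \<open>0 < L\<close> by (intro mult_mono) auto
      then show ?thesis by (simp add: Suc width_Suc mult.commute)
    qed
    \<comment> \<open>Words of the cell share projections only before the stopping time, so letter
      \<open>j\<close> must precede it. The factor 4 in the porosity constant ensures this.\<close>
    have "j \<noteq> ?n"
    proof
      assume "j = ?n"
      with wj_ge wn have "c * L / 3 \<le> r" by simp
      with r_le r show False by linarith
    qed
    then have "j < ?n" using \<open>j \<le> ?n\<close> by simp
    let ?w = "width T l \<omega> j" and ?p = "corner T b l \<omega> j"
    have "0 < ?w" using width_pos \<omega> l by blast
    have "\<omega> j < N" using \<omega> by (simp add: coding_def)
    then obtain \<alpha> where \<alpha>: "0 \<le> \<alpha>" "\<alpha> + \<epsilon> \<le> 1" and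
      avoid: "\<And>k'. k' < N \<Longrightarrow> same_proj T b l (\<omega> j) k' \<Longrightarrow> b k' l + T k' l \<le> \<alpha> \<or> \<alpha> + \<epsilon> \<le> b k' l"
      using gap unfolding fiber_gap_def by blast
    \<comment> \<open>Left end of the gap in the fiber of \<open>\<omega> j\<close>, carried into
      the box of generation \<open>j\<close>.\<close>
    define y' where "y' = ?p + ?w * \<alpha>"
    have z_j: "?p \<le> z" "z \<le> ?p + ?w"
      using side_antimono[OF \<omega>(1) l \<open>j \<le> ?n\<close>] z_side by (auto simp: side_def)
    have y'_gap: "y' + ?w * \<epsilon> \<le> ?p + ?w"
      using mult_left_mono[OF \<alpha>(2), of ?w] \<open>0 < ?w\<close> by (simp add: y'_def algebra_simps)
    have "e / 3 \<le> ?w * \<epsilon>"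
      using mult_right_mono[OF wj_ge, of \<epsilon>] \<epsilon> by (simp add: e_def algebra_simps)
    then have LQ_le: "L / ?Q \<le> ?w * \<epsilon>" using \<open>0 < e\<close> unfolding LQ by linarith
    have "\<zeta> \<notin> {y'<..<y' + ?w * \<epsilon>}" if "\<zeta> \<in> fiber_cover l r \<omega>0" for \<zeta>
    proof -
      obtain \<omega>' where \<omega>': "coding \<omega>'" "same_cell l r \<omega>0 \<omega>'" "\<zeta> \<in> side T b l \<omega>' (stop l r \<omega>')"
        using \<open>\<zeta> \<in> fiber_cover l r \<omega>0\<close> by (auto simp: fiber_cover_def)
      have cell: "same_cell l r \<omega> \<omega>'" by (rule same_cell_trans[OF same_cell_sym[OF \<omega>(2)] \<omega>'(2)])
      then have n': "stop l r \<omega>' = ?n" and same: "\<And>i. i < ?n \<Longrightarrow> same_proj T b l (\<omega> i) (\<omega>' i)"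
        by (auto simp: same_cell_def)
      have \<zeta>_j: "\<zeta> \<in> side T b l \<omega>' i" if "i \<le> ?n" for i
        using side_antimono[OF \<omega>'(1) l that] \<omega>'(3) n' by auto
      show ?thesis
      \<comment> \<open>Either \<open>\<omega>'\<close> has the same side \<open>l\<close> in
        generation \<open>j\<close>, and its letter \<open>j\<close> avoids the gap; or its side is
        separated from that of \<open>\<omega>\<close> in coordinate \<open>l\<close>, because the
        lower coordinates coincide.\<close>
      proof (cases "\<forall>i<j. same_proj T b (Suc l) (\<omega> i) (\<omega>' i)")
        case True
        then have w: "width T l \<omega>' j = ?w" and p: "corner T b l \<omega>' j = ?p"
          using same_proj_width[of j T b "Suc l" \<omega> \<omega>' l] same_proj_corner[of j T b "Suc l" \<omega> \<omega>' l]
          by auto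
        have "\<omega>' j < N" using \<omega>' by (simp add: coding_def)
        then have "?w * (b (\<omega>' j) l + T (\<omega>' j) l) \<le> ?w * \<alpha> \<or> ?w * (\<alpha> + \<epsilon>) \<le> ?w * b (\<omega>' j) l"
          using avoid[OF _ same[OF \<open>j < ?n\<close>]] \<open>0 < ?w\<close> by (simp add: mult_le_cancel_left_pos)
        moreover have "\<zeta> \<in> side T b l \<omega>' (Suc j)" using \<zeta>_j \<open>j < ?n\<close> by simp
        ultimately show ?thesis
          by (auto simp: y'_def side_def corner_Suc width_Suc w p algebra_simps)
      next
        case False
        then obtain i where i: "i < Suc l" and
          disj: "corner T b i \<omega> j + width T i \<omega> j \<le> corner T b i \<omega>' j \<or>
            corner T b i \<omega>' j + width T i \<omega>' j \<le> corner T b i \<omega> j"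
          using side_disjoint[OF \<omega>(1) \<omega>'(1), of "Suc l" j] l by auto
        have "i = l"
        proof (rule ccontr)
          assume "i \<noteq> l"
          then have "i < l" using i by simp
          then have "width T i \<omega> j = width T i \<omega>' j" "corner T b i \<omega> j = corner T b i \<omega>' j"
            using same \<open>j < ?n\<close> same_proj_width[of j T b l \<omega> \<omega>' i] same_proj_corner[of j T b l \<omega> \<omega>' i]
            by auto
          then show False using disj width_pos[OF \<omega>(1), of i j] \<open>i < l\<close> l by auto
        qed
        moreover have "\<zeta> \<in> side T b l \<omega>' j" using \<zeta>_j \<open>j < ?n\<close> by simp
        moreover have "?p \<le> y'" using \<alpha> \<open>0 < ?w\<close> by (simp add: y'_def)
        ultimately show ?thesis using disj y'_gap by (auto simp: side_def)
      qed
    qed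
    then have "{y'<..<y' + L / ?Q} \<inter> fiber_cover l r \<omega>0 = {}" using LQ_le by fastforce
    moreover have "y \<le> y'"
    proof -
      have "0 \<le> ?w * \<alpha>" using \<alpha> \<open>0 < ?w\<close> by simp
      then show ?thesis using z z_j wj by (simp add: y'_def)
    qed
    moreover have "y' + L / ?Q \<le> y + L" using y'_gap LQ_le z z_j wj by linarith
    ultimately show ?thesis by blast
  qed
qed

section \<open>Displacement of chains, by induction on the number of coordinates\<close>

text \<open>One constant \<open>C\<close> serves all scales \<open>r\<close> and all chain lengths;
  this uniformity becomes uniform disconnectedness. The coordinates from \<open>l\<close> on are
  left uncontrolled.\<close>

definition chain_bound :: "nat \<Rightarrow> real \<Rightarrow> bool" where
  "chain_bound l C \<longleftrightarrow> (\<forall>r>0. \<forall>m x. (\<forall>j\<le>m. \<exists>\<omega>. codes \<omega> (x j)) \<and>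
     (\<forall>j<m. \<forall>i<l. \<bar>x j i - x (Suc j) i\<bar> \<le> r) \<longrightarrow> (\<forall>i<l. \<bar>x 0 i - x m i\<bar> \<le> C * r))"

text \<open>By \<open>IH\<close> the chain stays within \<open>C * r\<close> of its start in the
  first \<open>l\<close> coordinates and so meets at most \<open>M\<close> cells. The union of the
  covers over them is porous with constant \<open>Q ^ M\<close>, and
  \<open>porous_chain_bound\<close> applies.\<close>

lemma chain_bound_Suc:
  assumes l: "l < d" and gap: "fiber_gap l \<epsilon>" and \<epsilon>: "0 < \<epsilon>" and IH: "chain_bound l C" and C: "0 \<le> C"
  obtains C' where "0 \<le> C'" "chain_bound (Suc l) C'"
proof -
  obtain c where c: "0 < c" "c \<le> 1" "\<And>k. k < N \<Longrightarrow> c \<le> T k l"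
    using ratio_lower_bound[OF l] by blast
  obtain M where M: "\<And>r a \<Omega>. \<lbrakk>0 < r; r < 1;
      \<And>\<omega>. \<omega> \<in> \<Omega> \<Longrightarrow> \<exists>x. codes \<omega> x \<and> (\<forall>i<l. \<bar>x i - a i\<bar> \<le> C * r)\<rbrakk> \<Longrightarrow>
    \<exists>R\<subseteq>\<Omega>. finite R \<and> card R \<le> M \<and> (\<forall>\<omega>\<in>\<Omega>. \<exists>\<omega>'\<in>R. same_cell l r \<omega>' \<omega>)"
    using card_cells_near[OF l C] by blast
  define Q where "Q = max 1 (4 / (c * \<epsilon>))"
  have Q: "1 \<le> Q" by (simp add: Q_def)
  have "chain_bound (Suc l) (max C (Q ^ M))"
    unfolding chain_bound_def
  proof (intro allI impI)
    fix r :: real and m and x :: "nat \<Rightarrow> nat \<Rightarrow> real" and i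
    assume r: "0 < r" and chain: "(\<forall>j\<le>m. \<exists>\<omega>. codes \<omega> (x j)) \<and>
      (\<forall>j<m. \<forall>i<Suc l. \<bar>x j i - x (Suc j) i\<bar> \<le> r)" and i: "i < Suc l"
    have low: "\<bar>x 0 i - x j i\<bar> \<le> C * r" if "i < l" "j \<le> m" for i j
      using IH[unfolded chain_bound_def, rule_format, of r j x i] r chain that by auto
    from chain obtain \<omega> where \<omega>: "\<And>j. j \<le> m \<Longrightarrow> codes (\<omega> j) (x j)" by metis
    have unit: "x j l \<in> {0..1}" if "j \<le> m" for j
    proof -
      have "x j l \<in> side T b l (\<omega> j) 0" using \<omega>[OF that] l unfolding codes_def by blast
      then show ?thesis by (simp add: side_def)
    qed
    have top: "\<bar>x 0 l - x m l\<bar> \<le> Q ^ M * r"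
    \<comment> \<open>For \<open>r \<ge> 1\<close> the bound holds because coordinate
      \<open>l\<close> stays in [0,1].\<close>
    proof (cases "r < 1")
      case False
      have "1 * 1 \<le> Q ^ M * r" using False Q by (intro mult_mono) auto
      then show ?thesis using unit[of 0] unit[of m] by (auto simp: abs_le_iff)
    next
      case True
      have "\<exists>y. codes \<omega>' y \<and> (\<forall>i<l. \<bar>y i - x 0 i\<bar> \<le> C * r)" if "\<omega>' \<in> \<omega> ` {..m}" for \<omega>'
        using that \<omega> low by (force simp: abs_minus_commute)
      from M[OF r True this] obtain R where R: "R \<subseteq> \<omega> ` {..m}" "finite R" "card R \<le> M"
        and rep: "\<And>j. j \<le> m \<Longrightarrow> \<exists>\<omega>'\<in>R. same_cell l r \<omega>' (\<omega> j)" by (metis atMost_iff image_eqI)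
      have "porous (\<Union>\<omega>'\<in>R. fiber_cover l r \<omega>') r (Q ^ card R)"
      proof (intro porous_Union R(2) Q)
        fix \<omega>' assume "\<omega>' \<in> R"
        then have cod: "coding \<omega>'" using R \<omega> by (auto simp: codes_def)
        have "\<epsilon> \<le> 1" using gap cod unfolding fiber_gap_def coding_def by force
        then have "1 \<le> 4 / (c * \<epsilon>)" using c \<epsilon> mult_le_one[of c \<epsilon>] by (simp add: le_divide_eq)
        with porous_fiber_cover[OF l gap \<epsilon> c cod r] show "porous (fiber_cover l r \<omega>') r Q"
          by (simp add: Q_def max_def)
      qed (use r in simp)
      then have por: "porous (\<Union>\<omega>'\<in>R. fiber_cover l r \<omega>') r (Q ^ M)"
        by (rule porous_mono) (use Q R r in \<open>auto intro: power_increasing one_le_power\<close>)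
      show ?thesis
      proof (rule porous_chain_bound[OF por])
        show "x j l \<in> (\<Union>\<omega>'\<in>R. fiber_cover l r \<omega>')" if j: "j \<le> m" for j
        proof -
          obtain \<omega>' where \<omega>': "\<omega>' \<in> R" "same_cell l r \<omega>' (\<omega> j)" using rep[OF j] by blast
          moreover have "x j l \<in> side T b l (\<omega> j) (stop l r (\<omega> j))" "coding (\<omega> j)"
            using \<omega>[OF j] l by (auto simp: codes_def)
          ultimately show ?thesis unfolding fiber_cover_def by blast
        qed
        show "\<bar>x j l - x (Suc j) l\<bar> \<le> r" if "j < m" for j using chain that by simp
        show "\<bar>x 0 l - x m l\<bar> \<le> 1" using unit[of 0] unit[of m] by (auto simp: abs_le_iff)
        show "1 \<le> Q ^ M" using Q by (rule one_le_power)
      qed (use r in simp)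
    qed
    show "\<bar>x 0 i - x m i\<bar> \<le> max C (Q ^ M) * r"
    proof (cases "i = l")
      case True
      have "Q ^ M * r \<le> max C (Q ^ M) * r" using r by (intro mult_right_mono) auto
      with top True show ?thesis by simp
    next
      case False
      have "C * r \<le> max C (Q ^ M) * r" using r by (intro mult_right_mono) auto
      with low[of i m] i False show ?thesis by simp
    qed
  qed
  with that[of "max C (Q ^ M)"] C show ?thesis by simp
qed

lemma chain_bound_exists:
  assumes "\<And>l. l < d \<Longrightarrow> \<exists>\<epsilon>>0. fiber_gap l \<epsilon>" "l \<le> d"
  shows "\<exists>C\<ge>0. chain_bound l C"
  using assms(2)
proof (induction l)
  case 0
  show ?case by (intro exI[of _ 0]) (simp add: chain_bound_def)
next
  case (Suc l)
  then obtain C where C: "0 \<le> C" "chain_bound l C" by auto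
  from Suc.prems have "l < d" by simp
  then obtain \<epsilon> where \<epsilon>: "0 < \<epsilon>" "fiber_gap l \<epsilon>" using assms(1) by blast
  obtain C' where "0 \<le> C'" "chain_bound (Suc l) C'"
    using chain_bound_Suc[OF \<open>l < d\<close> \<epsilon>(2,1) C(2,1)] .
  then show ?case by blast
qed

text \<open>A point outside finitely many closed intervals has a neighbourhood outside them; the
  minimum over the finitely many indices makes the length uniform.\<close>

lemma fiber_gap_exists:
  assumes l: "l < d" and uncovered: "\<And>k. k < N \<Longrightarrow>
    \<exists>t\<in>{0..1}. \<forall>k'<N. same_proj T b l k k' \<longrightarrow> t \<notin> {b k' l..b k' l + T k' l}"
  shows "\<exists>\<epsilon>>0. fiber_gap l \<epsilon>"
proof -
  have "\<forall>k\<in>{..<N}. \<exists>\<epsilon>>0. \<exists>\<alpha>\<ge>0. \<alpha> + \<epsilon> \<le> 1 \<and>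
    (\<forall>k'<N. same_proj T b l k k' \<longrightarrow> b k' l + T k' l \<le> \<alpha> \<or> \<alpha> + \<epsilon> \<le> b k' l)"
  proof
    fix k assume "k \<in> {..<N}"
    then obtain t where t: "0 \<le> t" "t \<le> 1"
      and t_out: "\<And>k'. k' < N \<Longrightarrow> same_proj T b l k k' \<Longrightarrow> t \<notin> {b k' l..b k' l + T k' l}"
      using uncovered[of k] by auto
    let ?F = "\<Union>k'\<in>{k'. k' < N \<and> same_proj T b l k k'}. {b k' l..b k' l + T k' l}"
    have "closed ?F" by (intro closed_UN) auto
    moreover have "t \<notin> ?F" using t_out by auto
    ultimately obtain e where e: "0 < e" "ball t e \<subseteq> - ?F"
      by (meson open_Compl open_contains_ball ComplI)
    \<comment> \<open>The gap starts or ends at \<open>t\<close>; with length at most 1/2 one of the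
      two choices keeps it in [0,1].\<close>
    define \<epsilon> where "\<epsilon> = min (e / 2) (1 / 2)"
    define \<alpha> where "\<alpha> = (if t \<le> 1 / 2 then t else t - \<epsilon>)"
    have \<epsilon>: "0 < \<epsilon>" "\<epsilon> < e" "\<epsilon> \<le> 1 / 2" using e by (auto simp: \<epsilon>_def)
    have \<alpha>: "0 \<le> \<alpha>" "\<alpha> + \<epsilon> \<le> 1" "t - e < \<alpha>" "\<alpha> + \<epsilon> < t + e"
      using \<epsilon> t by (auto simp: \<alpha>_def)
    have "b k' l + T k' l \<le> \<alpha> \<or> \<alpha> + \<epsilon> \<le> b k' l" if k': "k' < N" "same_proj T b l k k'" for k'
    proof (rule ccontr)
      assume "\<not> ?thesis"
      then have "max \<alpha> (b k' l) \<in> {b k' l..b k' l + T k' l}" "max \<alpha> (b k' l) \<in> ball t e"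
        using \<alpha> \<epsilon> T_pos[OF k'(1) l] by (auto simp: dist_real_def)
      with e k' show False by blast
    qed
    with \<epsilon> \<alpha> show "\<exists>\<epsilon>>0. \<exists>\<alpha>\<ge>0. \<alpha> + \<epsilon> \<le> 1 \<and>
      (\<forall>k'<N. same_proj T b l k k' \<longrightarrow> b k' l + T k' l \<le> \<alpha> \<or> \<alpha> + \<epsilon> \<le> b k' l)" by blast
  qed
  from bchoice[OF this] obtain \<epsilon> where \<epsilon>: "\<And>k. k < N \<Longrightarrow> 0 < \<epsilon> k" and
    gap: "\<And>k. k < N \<Longrightarrow> \<exists>\<alpha>\<ge>0. \<alpha> + \<epsilon> k \<le> (1::real) \<and>
      (\<forall>k'<N. same_proj T b l k k' \<longrightarrow> b k' l + T k' l \<le> \<alpha> \<or> \<alpha> + \<epsilon> k \<le> b k' l)" by auto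
  define \<epsilon>0 where "\<epsilon>0 = Min (insert 1 (\<epsilon> ` {..<N}))"
  have "0 < \<epsilon>0" unfolding \<epsilon>0_def using \<epsilon> by (subst Min_gr_iff) auto
  moreover have "fiber_gap l \<epsilon>0"
    unfolding fiber_gap_def
  proof (intro allI impI)
    fix k assume k: "k < N"
    have "\<epsilon>0 \<le> \<epsilon> k" unfolding \<epsilon>0_def by (rule Min_le) (use k in auto)
    with gap[OF k] show "\<exists>\<alpha>\<ge>0. \<alpha> + \<epsilon>0 \<le> 1 \<and>
      (\<forall>k'<N. same_proj T b l k k' \<longrightarrow> b k' l + T k' l \<le> \<alpha> \<or> \<alpha> + \<epsilon>0 \<le> b k' l)"
      by (meson add_left_mono order_trans)
  qed
  ultimately show ?thesis by blast
qed

text \<open>As [0,1] is compact and nonempty, only the invariance equation is left, and the maps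
  send [0,1] onto explicit intervals.\<close>

lemma fiber_attractor_unit_iff:
  assumes "k < N" "l < d"
  shows "is_attractor euclideanreal (fiber_ifs N T b l (diag_affine l (T k) (b k))) {0..1} \<longleftrightarrow>
    {0..1} = (\<Union>k'\<in>{k'. k' < N \<and> same_proj T b l k k'}. {b k' l..b k' l + T k' l})"
proof -
  have contractive: "diagonal_contractive d N T"
    using T_pos T_less_1 by (auto simp: diagonal_contractive_def)
  have image: "(\<lambda>x. T k' l * x + b k' l) ` {0..1} = {b k' l..b k' l + T k' l}" if "k' < N" for k'
    using T_pos[OF that assms(2)] by (subst image_affinity_atLeastAtMost) (auto simp: add.commute)
  have "(\<Union>k'\<in>{k'. k' < N \<and> same_proj T b l k k'}. (\<lambda>x. T k' l * x + b k' l) ` {0..1}) =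
    (\<Union>k'\<in>{k'. k' < N \<and> same_proj T b l k k'}. {b k' l..b k' l + T k' l})"
    by (intro SUP_cong refl image) simp
  then show ?thesis
    by (simp add: is_attractor_def fiber_ifs_eq[OF contractive assms(2)])
qed

section \<open>From the chain bound to disconnectedness\<close>

text \<open>Along a \<open>\<delta>\<close>-sequence with end points at distance \<open>D\<close>
  each coordinate moves by at most \<open>C * \<delta> * D\<close>. The sum over \<open>d\<close>
  coordinates is less than \<open>D\<close> for \<open>\<delta> = 1 / (d * C + 1)\<close>.\<close>

lemma uniformly_disconnected_if_chain_bound:
  assumes bound: "chain_bound d C" "0 \<le> C" and coded: "\<And>x. x \<in> K \<Longrightarrow> \<exists>\<omega>. codes \<omega> x"
    and K: "K \<subseteq> topspace (Euclidean_space d)"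
  shows "uniformly_disconnected K (eucl_dist d)"
  unfolding uniformly_disconnected_def
proof (intro exI conjI notI)
  define \<delta> where "\<delta> = 1 / (d * C + 1)"
  have pos: "0 < d * C + 1" using bound by (simp add: add_nonneg_pos)
  then show "0 < \<delta>" by (simp add: \<delta>_def)
  assume "\<exists>n x. delta_sequence K (eucl_dist d) \<delta> n x"
  then obtain n x where ds: "delta_sequence K (eucl_dist d) \<delta> n x" by blast
  then have n: "1 \<le> n" and inj: "inj_on x {0..n}"
    and step: "\<And>j. j < n \<Longrightarrow> eucl_dist d (x j) (x (Suc j)) \<le> \<delta> * eucl_dist d (x 0) (x n)"
    by (auto simp: delta_sequence_def)
  have xK: "x j \<in> K" if "j \<le> n" for j
    using ds that by (auto simp: delta_sequence_def)
  define D where "D = eucl_dist d (x 0) (x n)"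
  have le_dist: "\<bar>y i - z i\<bar> \<le> eucl_dist d y z" if "i < d" for i y z
    using member_le_L2_set[of "{..<d}" i "\<lambda>i. \<bar>y i - z i\<bar>"] that by (simp add: eucl_dist_def L2_set_def)
  \<comment> \<open>Distinct points of \<open>K\<close> differ in a coordinate below
    \<open>d\<close>, because all others vanish; hence \<open>D > 0\<close>.\<close>
  have "x 0 \<noteq> x n" using inj n inj_onD[OF inj, of 0 n] by auto
  then obtain i where i: "x 0 i \<noteq> x n i" by blast
  have "x 0 \<in> topspace (Euclidean_space d)" "x n \<in> topspace (Euclidean_space d)"
    using xK[of 0] xK[of n] K by auto
  then have "x 0 i = x n i" if "d \<le> i" using that by (simp add: topspace_Euclidean_space)
  with i have "i < d" by fastforce
  then have "0 < D" unfolding D_def using le_dist[of i "x 0" "x n"] i by linarith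
  have "\<bar>x j i - x (Suc j) i\<bar> \<le> \<delta> * D" if "j < n" "i < d" for i j
    using le_dist[OF that(2)] step[OF that(1)] unfolding D_def by (rule order_trans)
  then have small: "\<bar>x 0 i - x n i\<bar> \<le> C * (\<delta> * D)" if "i < d" for i
    using bound(1)[unfolded chain_bound_def, rule_format, of "\<delta> * D" n x i] that coded xK
      \<open>0 < \<delta>\<close> \<open>0 < D\<close> by simp
  have "D \<le> (\<Sum>i<d. \<bar>x 0 i - x n i\<bar>)" unfolding D_def eucl_dist_def by (rule L2_set_le_sum_abs)
  also have "\<dots> \<le> (\<Sum>i<d. C * (\<delta> * D))" using small by (intro sum_mono) simp
  also have "\<dots> = D * ((d * C) / (d * C + 1))" by (simp add: \<delta>_def)
  also have "\<dots> < D * 1" using pos \<open>0 < D\<close> by (intro mult_strict_left_mono) auto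
  finally show False by simp
qed

text \<open>Any two points of a connected set are joined by chains with arbitrarily small steps
  \<open>r\<close>. Lifted to \<open>K\<close>, such a chain moves by at most \<open>C * r\<close>
  in each coordinate below \<open>l\<close>, so the two points agree.\<close>

lemma totally_disconnected_if_chain_bound:
  assumes bound: "chain_bound l C" "0 \<le> C" and coded: "\<And>x. x \<in> K \<Longrightarrow> \<exists>\<omega>. codes \<omega> x"
  shows "totally_disconnected_in (Euclidean_space l) (coord_proj l ` K)"
  unfolding totally_disconnected_in_def
proof (intro conjI allI impI)
  show "coord_proj l ` K \<subseteq> topspace (Euclidean_space l)"
    by (auto simp: topspace_Euclidean_space coord_proj_def)
  fix S assume S: "connectedin (Euclidean_space l) S \<and> S \<subseteq> coord_proj l ` K"
  have "a = z" if a: "a \<in> S" and z: "z \<in> S" for a z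
  proof
    fix i
    define reach where "reach r z \<longleftrightarrow> (\<exists>m x. (\<forall>j\<le>m. x j \<in> K) \<and>
      (\<forall>j<m. \<forall>i<l. \<bar>x j i - x (Suc j) i\<bar> \<le> r) \<and> coord_proj l (x 0) = a \<and> coord_proj l (x m) = z)"
      for r z
    have reach_start: "reach r a" for r
    proof -
      obtain x0 where "x0 \<in> K" "coord_proj l x0 = a" using a S by blast
      then show ?thesis unfolding reach_def by (intro exI[of _ 0] exI[of _ "\<lambda>_. x0"]) auto
    qed
    have reach_step: "reach r z'"
      if "reach r z" "z' \<in> S" and near: "\<And>i. i < l \<Longrightarrow> \<bar>z i - z' i\<bar> \<le> r" for r z z'
    proof -
      obtain m x where x: "\<forall>j\<le>m. x j \<in> K" "\<forall>j<m. \<forall>i<l. \<bar>x j i - x (Suc j) i\<bar> \<le> r"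
        "coord_proj l (x 0) = a" "coord_proj l (x m) = z"
        using \<open>reach r z\<close> unfolding reach_def by blast
      obtain w where w: "w \<in> K" "coord_proj l w = z'" using \<open>z' \<in> S\<close> S by blast
      have "\<bar>x m i - w i\<bar> \<le> r" if "i < l" for i
        using near[OF that] that x(4) w(2) by (auto simp: coord_proj_def)
      with x w show ?thesis unfolding reach_def
        by (intro exI[of _ "Suc m"] exI[of _ "x(Suc m := w)"]) (auto simp: le_Suc_eq less_Suc_eq)
    qed
    have reach_all: "reach r z" if r: "0 < r" for r
    proof (rule ccontr)
      assume nz: "\<not> reach r z"
      \<comment> \<open>With radius \<open>r / 2\<close>, if neighbourhoods of two points of
        \<open>S\<close> meet, one further step leads from one point to the other.\<close>
      define near where "near Z = {y \<in> topspace (Euclidean_space l). \<exists>z\<in>Z. \<forall>i<l. \<bar>y i - z i\<bar> < r / 2}"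
        for Z
      let ?U = "near {z \<in> S. reach r z}" and ?V = "near {z \<in> S. \<not> reach r z}"
      have near_self: "y \<in> near Z" if "y \<in> Z" "y \<in> S" for y Z
      proof -
        have "y \<in> topspace (Euclidean_space l)" using S that connectedin_subset_topspace by blast
        then show ?thesis unfolding near_def using that r by (auto intro!: bexI[of _ y])
      qed
      have "?U \<inter> ?V \<inter> S = {}"
      proof (rule ccontr)
        assume "\<not> ?thesis"
        then obtain y u v where u: "u \<in> S" "reach r u" "\<forall>i<l. \<bar>y i - u i\<bar> < r / 2"
          and v: "v \<in> S" "\<not> reach r v" "\<forall>i<l. \<bar>y i - v i\<bar> < r / 2"
          by (auto simp: near_def)
        have "\<bar>u i - v i\<bar> \<le> r" if "i < l" for i
          using u(3)[rule_format, OF that] v(3)[rule_format, OF that] by linarith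
        from reach_step[OF u(2) v(1) this] v(2) show False by blast
      qed
      moreover have "S \<subseteq> ?U \<union> ?V"
      proof
        fix y assume "y \<in> S"
        then show "y \<in> ?U \<union> ?V"
          using near_self[of y "{z \<in> S. reach r z}"] near_self[of y "{z \<in> S. \<not> reach r z}"]
          by (cases "reach r y") simp_all
      qed
      moreover have "a \<in> ?U" by (rule near_self) (simp_all add: a reach_start)
      moreover have "z \<in> ?V" by (rule near_self) (simp_all add: z nz)
      moreover have "openin (Euclidean_space l) ?U" "openin (Euclidean_space l) ?V"
        unfolding near_def by (rule openin_Euclidean_space_near)+
      ultimately show False using connectedinD[OF conjunct1[OF S], of ?U ?V] a z by blast
    qed
    show "a i = z i"
    proof (cases "i < l")
      case True
      have "\<bar>a i - z i\<bar> \<le> C * r" if r: "0 < r" for r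
      proof -
        obtain m x where x: "\<forall>j\<le>m. x j \<in> K" "\<forall>j<m. \<forall>i<l. \<bar>x j i - x (Suc j) i\<bar> \<le> r"
          "coord_proj l (x 0) = a" "coord_proj l (x m) = z"
          using reach_all[OF r] unfolding reach_def by blast
        have "\<bar>x 0 i - x m i\<bar> \<le> C * r"
          using bound(1)[unfolded chain_bound_def, rule_format, OF r conjI[OF _ x(2)] True] x(1) coded
          by simp
        then show ?thesis using True x(3,4) by (auto simp: coord_proj_def)
      qed
      note small = this
      have "\<bar>a i - z i\<bar> \<le> 0 + e" if "0 < e" for e
      proof -
        \<comment> \<open>Dividing by \<open>C + 1\<close> covers \<open>C = 0\<close>.\<close>
        have "\<bar>a i - z i\<bar> \<le> C * (e / (C + 1))" using small[of "e / (C + 1)"] that bound(2) by simp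
        also have "\<dots> \<le> e" using that bound(2) by (simp add: field_simps)
        finally show ?thesis by simp
      qed
      then have "\<bar>a i - z i\<bar> \<le> 0" by (rule field_le_epsilon)
      then show ?thesis by simp
    next
      case False
      have "a \<in> topspace (Euclidean_space l)" "z \<in> topspace (Euclidean_space l)"
        using a z S connectedin_subset_topspace by blast+
      then show ?thesis using False by (simp add: topspace_Euclidean_space)
    qed
  qed
  then show "\<exists>a. S \<subseteq> {a}" by blast
qed

subsection \<open>Segments over covered fibers\<close>

lemma side_unique:
  assumes "coding \<omega>" "i < d" "\<And>n. x \<in> side T b i \<omega> n" "\<And>n. y \<in> side T b i \<omega> n"
  shows "x = y"
proof -
  have "\<bar>x - y\<bar> \<le> width T i \<omega> n" for n
    using assms(3,4)[of n] by (auto simp: side_def)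
  with width_tendsto_0[OF assms(1,2)] have "\<bar>x - y\<bar> \<le> 0" by (intro LIMSEQ_le_const) auto
  then show ?thesis by simp
qed

text \<open>Applying the maps of a prefix to a point of \<open>K\<close> gives a point of
  \<open>K\<close> in the corresponding box. A limit point of these works for all prefixes, since
  the sides are nested and closed.\<close>

lemma codes_point_exists:
  assumes K: "compact K" "K \<noteq> {}" "K \<subseteq> closed_unit_cube d"
    and inv: "\<And>k x. k < N \<Longrightarrow> x \<in> K \<Longrightarrow> diag_affine d (T k) (b k) x \<in> K"
    and \<omega>: "coding \<omega>"
  shows "\<exists>x\<in>K. codes \<omega> x"
proof -
  have "\<exists>x\<in>K. \<forall>i<d. x i \<in> side T b i \<omega> n" for n
    using \<omega>
  proof (induction n arbitrary: \<omega>)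
    case 0
    then show ?case using K(2,3) by (fastforce simp: side_def closed_unit_cube_def)
  next
    case (Suc n)
    have "\<omega> 0 < N" "coding (\<lambda>j. \<omega> (Suc j))" using Suc.prems by (auto simp: coding_def)
    with Suc.IH obtain x where x: "x \<in> K" "\<And>i. i < d \<Longrightarrow> x i \<in> side T b i (\<lambda>j. \<omega> (Suc j)) n"
      by blast
    have "diag_affine d (T (\<omega> 0)) (b (\<omega> 0)) x i \<in> side T b i \<omega> (Suc n)" if i: "i < d" for i
    proof -
      have "T (\<omega> 0) i * corner T b i (\<lambda>j. \<omega> (Suc j)) n \<le> T (\<omega> 0) i * x i"
        "T (\<omega> 0) i * x i \<le>
          T (\<omega> 0) i * (corner T b i (\<lambda>j. \<omega> (Suc j)) n + width T i (\<lambda>j. \<omega> (Suc j)) n)"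
        using x(2)[OF i] T_pos[OF \<open>\<omega> 0 < N\<close> i] by (auto simp: side_def)
      then show ?thesis using i
        by (simp add: side_def diag_affine_def corner_Suc_shift width_Suc_shift distrib_left)
    qed
    with inv[OF \<open>\<omega> 0 < N\<close> x(1)] show ?case by blast
  qed
  then obtain X where X: "\<And>n. X n \<in> K" "\<And>n i. i < d \<Longrightarrow> X n i \<in> side T b i \<omega> n" by metis
  obtain x s where x: "x \<in> K" "strict_mono s" "(X \<circ> s) \<longlonglongrightarrow> x"
    using seq_compactE[OF compact_imp_seq_compact[OF K(1)]] X(1) by blast
  have "x i \<in> side T b i \<omega> m" if i: "i < d" for i m
  proof (rule Lim_in_closed_set)
    show "closed (side T b i \<omega> m)" by (simp add: side_def)
    have "isCont (\<lambda>x::nat \<Rightarrow> real. x i) x"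
      using continuous_on_product_coordinates[of i] continuous_on_eq_continuous_at[OF open_UNIV]
      by blast
    from isCont_tendsto_compose[OF this x(3)] show "(\<lambda>n. X (s n) i) \<longlonglongrightarrow> x i" by simp
    show "\<forall>\<^sub>F n in sequentially. X (s n) i \<in> side T b i \<omega> m"
      unfolding eventually_sequentially
    proof (intro exI[of _ m] allI impI)
      fix n assume "m \<le> n"
      also have "n \<le> s n" by (rule seq_suble[OF x(2)])
      finally show "X (s n) i \<in> side T b i \<omega> m"
        using X(2)[OF i, of "s n"] side_antimono[OF \<omega> i] by blast
    qed
  qed simp
  with x(1) \<omega> show ?thesis by (auto simp: codes_def)
qed

text \<open>A covered fiber system produces a segment over the fixed point of the projected map.\<close>

lemma fiber_segment:
  assumes K: "compact K" "K \<noteq> {}" "K \<subseteq> closed_unit_cube d"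
    and inv: "\<And>k x. k < N \<Longrightarrow> x \<in> K \<Longrightarrow> diag_affine d (T k) (b k) x \<in> K"
    and k: "k < N" and l: "l < d"
    and covered: "{0..1} \<subseteq> (\<Union>k'\<in>{k'. k' < N \<and> same_proj T b l k k'}. {b k' l..b k' l + T k' l})"
  obtains x where "\<And>t. t \<in> {0..1} \<Longrightarrow> x t \<in> K" "\<And>t. t \<in> {0..1} \<Longrightarrow> x t l = t"
    "\<And>t t' i. t \<in> {0..1} \<Longrightarrow> t' \<in> {0..1} \<Longrightarrow> i < l \<Longrightarrow> x t i = x t' i"
proof -
  \<comment> \<open>Each \<open>t\<close> in [0,1] is the image of some \<open>s\<close> in [0,1]
    under a map of the fiber; iterating this choice reads off an address of \<open>t\<close> with
    letters from this fiber only.\<close>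
  have "\<exists>k' s. t \<in> {0..1} \<longrightarrow> k' < N \<and> same_proj T b l k k' \<and> s \<in> {0..1} \<and> t = T k' l * s + b k' l"
    for t
  proof (cases "t \<in> {0..1}")
    case True
    with covered obtain k' where k': "k' < N" "same_proj T b l k k'" "t \<in> {b k' l..b k' l + T k' l}"
      by blast
    then have "(t - b k' l) / T k' l \<in> {0..1}" "t = T k' l * ((t - b k' l) / T k' l) + b k' l"
      using T_pos[OF k'(1) l] by auto
    with k' show ?thesis by blast
  qed blast
  then obtain k' s where ks: "\<And>t. t \<in> {0..1} \<Longrightarrow> k' t < N"
    "\<And>t. t \<in> {0..1} \<Longrightarrow> same_proj T b l k (k' t)" "\<And>t. t \<in> {0..1} \<Longrightarrow> s t \<in> {0..1}"
    "\<And>t. t \<in> {0..1} \<Longrightarrow> t = T (k' t) l * s t + b (k' t) l"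
    by metis
  define orb where "orb t n = (s ^^ n) t" for t n
  define \<omega> where "\<omega> t n = k' (orb t n)" for t n
  have orb_in: "orb t n \<in> {0..1}" if "t \<in> {0..1}" for n t
    unfolding orb_def by (induction n) (use that ks(3) in auto)
  have orb_Suc: "orb t n = T (\<omega> t n) l * orb t (Suc n) + b (\<omega> t n) l" if "t \<in> {0..1}" for n t
    using ks(4)[OF orb_in[OF that, of n]] by (simp add: \<omega>_def orb_def)
  have cod: "coding (\<omega> t)" if "t \<in> {0..1}" for t
    using ks(1)[OF orb_in[OF that]] by (simp add: coding_def \<omega>_def)
  have "t \<in> side T b l (\<omega> t) n" if t: "t \<in> {0..1}" for t n
  proof -
    have "t = corner T b l (\<omega> t) n + width T l (\<omega> t) n * orb t n"
    proof (induction n)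
      case 0
      show ?case by (simp add: orb_def)
    next
      case (Suc n)
      then show ?case by (simp add: orb_Suc[OF t, of n] corner_Suc width_Suc algebra_simps)
    qed
    moreover have "0 \<le> width T l (\<omega> t) n * orb t n"
      "width T l (\<omega> t) n * orb t n \<le> width T l (\<omega> t) n * 1"
      using orb_in[OF t, of n] width_pos[OF cod[OF t] l, of n] by (auto intro!: mult_left_mono)
    ultimately show ?thesis unfolding side_def atLeastAtMost_iff by linarith
  qed
  note t_side = this
  have "\<forall>t\<in>{0..1}. \<exists>x. x \<in> K \<and> codes (\<omega> t) x"
    using codes_point_exists[OF K inv cod] by blast
  from bchoice[OF this] obtain x where x: "\<And>t. t \<in> {0..1} \<Longrightarrow> x t \<in> K"
    "\<And>t. t \<in> {0..1} \<Longrightarrow> codes (\<omega> t) (x t)" by blast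
  show ?thesis
  proof (rule that[of x])
    show "x t \<in> K" if "t \<in> {0..1}" for t by (rule x(1)[OF that])
    show "x t l = t" if t: "t \<in> {0..1}" for t
      by (rule side_unique[OF cod[OF t] l]) (use x(2)[OF t] l t_side[OF t] in \<open>auto simp: codes_def\<close>)
    show "x t i = x t' i" if t: "t \<in> {0..1}" "t' \<in> {0..1}" "i < l" for t t' i
    proof (rule side_unique[OF cod[OF t(1)]])
      show "i < d" using \<open>i < l\<close> l by simp
      then show "x t i \<in> side T b i (\<omega> t) n" for n using x(2)[OF t(1)] by (simp add: codes_def)
      \<comment> \<open>All letters have the projection of map \<open>k\<close>, so the projected
        words for \<open>t\<close> and \<open>t'\<close> coincide.\<close>
      have same: "same_proj T b l (\<omega> t j) (\<omega> t' j)" for j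
        using ks(2)[OF orb_in[OF t(1)]] ks(2)[OF orb_in[OF t(2)]] same_proj_sym same_proj_trans
        unfolding \<omega>_def by blast
      have "side T b i (\<omega> t) n = side T b i (\<omega> t') n" for n
        using same_proj_width[OF same \<open>i < l\<close>, where n = n]
          same_proj_corner[OF same \<open>i < l\<close>, where n = n]
        by (simp add: side_def)
      then show "x t' i \<in> side T b i (\<omega> t) n" for n
        using x(2)[OF t(2)] \<open>i < d\<close> by (simp add: codes_def)
    qed
  qed
qed

text \<open>The \<open>m\<close>-th iterate of one map scales direction \<open>l\<close> by
  \<open>T k l ^ m\<close> and each later direction by the same power of a smaller ratio. Relative
  to direction \<open>l\<close> the later ones become negligible, and the earlier coordinates are
  constant along the segment.\<close>

lemma segment_not_uniformly_disconnected:
  assumes x: "\<And>t. t \<in> {0..1} \<Longrightarrow> x t \<in> K" "\<And>t. t \<in> {0..1} \<Longrightarrow> x t l = t"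
    and const: "\<And>t t' i. t \<in> {0..1} \<Longrightarrow> t' \<in> {0..1} \<Longrightarrow> i < l \<Longrightarrow> x t i = x t' i"
    and K: "K \<subseteq> closed_unit_cube d"
    and inv: "\<And>k x. k < N \<Longrightarrow> x \<in> K \<Longrightarrow> diag_affine d (T k) (b k) x \<in> K"
    and k: "k < N" and l: "l < d"
  shows "\<not> uniformly_disconnected K (eucl_dist d)"
  unfolding uniformly_disconnected_def
proof (intro notI, elim exE conjE)
  fix \<delta> :: real
  assume \<delta>: "0 < \<delta>" and none: "\<not> (\<exists>n x. delta_sequence K (eucl_dist d) \<delta> n x)"
  let ?\<phi> = "diag_affine d (T k) (b k)"
  let ?S = "{i \<in> {..<d}. l < i}"
  have Tl: "0 < T k l" by (rule T_pos[OF k l])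
  \<comment> \<open>Half of \<open>\<delta>\<close> is spent on the spacing \<open>1 / q\<close>,
    the other half on the coordinates above \<open>l\<close>.\<close>
  obtain q0 where "inverse (real (Suc q0)) < \<delta> / 2" using reals_Archimedean[of "\<delta> / 2"] \<delta> by auto
  then obtain q :: nat where q: "0 < q" "1 / q < \<delta> / 2"
    by (metis inverse_eq_divide zero_less_Suc)
  have "(\<lambda>m. \<Sum>i\<in>?S. (T k i / T k l) ^ m) \<longlonglongrightarrow> 0"
  proof (rule tendsto_null_sum)
    fix i assume "i \<in> ?S"
    then have "T k i < T k l" "0 < T k i" using T_decr[OF k] T_pos[OF k] by auto
    then show "(\<lambda>m. (T k i / T k l) ^ m) \<longlonglongrightarrow> 0" by (intro LIMSEQ_power_zero) auto
  qed
  then have "\<forall>\<^sub>F m in sequentially. (\<Sum>i\<in>?S. (T k i / T k l) ^ m) < \<delta> / 2"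
    by (rule order_tendstoD) (use \<delta> in simp)
  then obtain m where m: "(\<Sum>i\<in>?S. (T k i / T k l) ^ m) < \<delta> / 2"
    unfolding eventually_sequentially by blast
  have pow_K: "(?\<phi> ^^ m) y \<in> K" if "y \<in> K" for m y
    by (induction m) (use that inv[OF k] in auto)
  have pow_diff: "(?\<phi> ^^ m) y i - (?\<phi> ^^ m) z i = T k i ^ m * (y i - z i)" if "i < d" for m y z i
  proof (induction m)
    case (Suc m)
    have "(?\<phi> ^^ Suc m) y i - (?\<phi> ^^ Suc m) z i = T k i * ((?\<phi> ^^ m) y i - (?\<phi> ^^ m) z i)"
      using that by (simp add: diag_affine_def right_diff_distrib)
    with Suc show ?case by simp
  qed simp
  define y where "y j = (?\<phi> ^^ m) (x (j / q))" for j :: nat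
  have unit: "real j / q \<in> {0..1}" if "j \<le> q" for j
    using that q by auto
  have yl: "y j l - y j' l = T k l ^ m * ((real j - real j') / q)" if "j \<le> q" "j' \<le> q" for j j'
    using pow_diff[OF l] x(2)[OF unit[OF that(1)]] x(2)[OF unit[OF that(2)]]
    by (simp add: y_def diff_divide_distrib)
  have le_dist: "T k l ^ m \<le> eucl_dist d (y 0) (y q)"
  proof -
    have "T k l ^ m = \<bar>y 0 l - y q l\<bar>" using yl[of 0 q] q Tl by (simp add: abs_mult)
    also have "\<dots> \<le> eucl_dist d (y 0) (y q)"
      using member_le_L2_set[of "{..<d}" l "\<lambda>i. \<bar>y 0 i - y q i\<bar>"] l by (simp add: eucl_dist_def L2_set_def)
    finally show ?thesis .
  qed
  have "delta_sequence K (eucl_dist d) \<delta> q y"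
    unfolding delta_sequence_def
  proof (intro conjI allI impI)
    show "1 \<le> q" using q by simp
    show "y ` {0..q} \<subseteq> K"
    proof (intro image_subsetI)
      fix j assume "j \<in> {0..q}"
      then show "y j \<in> K" unfolding y_def by (intro pow_K x(1) unit) simp
    qed
    show "inj_on y {0..q}"
    proof (rule inj_onI)
      fix j j' assume j: "j \<in> {0..q}" "j' \<in> {0..q}" "y j = y j'"
      then have "T k l ^ m * ((real j - real j') / q) = 0" using yl[of j j'] by simp
      then show "j = j'" using Tl q by simp
    qed
    fix j assume j: "j < q"
    let ?u = "real j / q" and ?v = "real (Suc j) / q"
    have uv: "?u \<in> {0..1}" "?v \<in> {0..1}" using unit[of j] unit[of "Suc j"] j by auto
    \<comment> \<open>Above \<open>l\<close> the only information on the segment is that it lies in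
      the unit cube; the factor \<open>T k i ^ m\<close> makes that suffice.\<close>
    have "\<bar>y j i - y (Suc j) i\<bar> \<le> (if i = l then T k l ^ m / q else 0) + (if l < i then T k i ^ m else 0)"
      if i: "i < d" for i
    proof -
      have eq: "\<bar>y j i - y (Suc j) i\<bar> = T k i ^ m * \<bar>x ?u i - x ?v i\<bar>"
        unfolding y_def pow_diff[OF i] using T_pos[OF k i] by (simp add: abs_mult)
      consider "i < l" | "i = l" | "l < i" by linarith
      then show ?thesis
      proof cases
        case 1
        then show ?thesis using eq const[OF uv] by simp
      next
        case 2
        then have "\<bar>x ?u i - x ?v i\<bar> = 1 / q"
          using x(2)[OF uv(1)] x(2)[OF uv(2)] q by (simp flip: diff_divide_distrib)
        then show ?thesis using eq 2 by simp
      next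
        case 3
        have "x ?u i \<in> {0..1}" "x ?v i \<in> {0..1}"
          using x(1)[OF uv(1)] x(1)[OF uv(2)] K i by (auto simp: closed_unit_cube_def)
        then have "\<bar>x ?u i - x ?v i\<bar> \<le> 1" by (auto simp: abs_le_iff)
        then have "T k i ^ m * \<bar>x ?u i - x ?v i\<bar> \<le> T k i ^ m * 1"
          using T_pos[OF k i] by (intro mult_left_mono) auto
        then show ?thesis using eq 3 by simp
      qed
    qed
    note coord = this
    have "eucl_dist d (y j) (y (Suc j)) \<le> (\<Sum>i<d. \<bar>y j i - y (Suc j) i\<bar>)"
      unfolding eucl_dist_def by (rule L2_set_le_sum_abs)
    also have "\<dots> \<le> (\<Sum>i<d. (if i = l then T k l ^ m / q else 0) + (if l < i then T k i ^ m else 0))"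
      using coord by (intro sum_mono) simp
    also have "\<dots> = T k l ^ m / q + (\<Sum>i\<in>?S. T k i ^ m)"
      using l by (simp add: sum.distrib flip: sum.inter_filter)
    also have "(\<Sum>i\<in>?S. T k i ^ m) = T k l ^ m * (\<Sum>i\<in>?S. (T k i / T k l) ^ m)"
      using Tl by (simp add: sum_distrib_left power_divide)
    also have "T k l ^ m / q + T k l ^ m * (\<Sum>i\<in>?S. (T k i / T k l) ^ m) =
        T k l ^ m * (1 / q + (\<Sum>i\<in>?S. (T k i / T k l) ^ m))"
      by (simp add: distrib_left)
    also have "\<dots> \<le> T k l ^ m * \<delta>" using q m Tl by (intro mult_left_mono) auto
    also have "\<dots> \<le> eucl_dist d (y 0) (y q) * \<delta>" using le_dist \<delta> by (intro mult_right_mono) auto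
    finally show "eucl_dist d (y j) (y (Suc j)) \<le> \<delta> * eucl_dist d (y 0) (y q)"
      by (simp add: mult.commute)
  qed
  with none show False by blast
qed

end

section \<open>Equivalence of both forms of disconnectedness with gaps in all fibers\<close>

theorem theorem1p3:
  fixes d N :: nat
    and T b :: "nat \<Rightarrow> nat \<Rightarrow> real"
    and K :: "(nat \<Rightarrow> real) set"
  assumes "d \<ge> 1"
    and "lalley_gatzouras d N T b"
    and "is_attractor (Euclidean_space d) (projected_ifs N T b d) K"
    and "K \<subseteq> closed_unit_cube d"
  shows "(uniformly_disconnected K (eucl_dist d) \<longleftrightarrow>
          (\<forall>l\<in>{1..d}. totally_disconnected_in (Euclidean_space l) (coord_proj l ` K))) \<and>
         ((\<forall>l\<in>{1..d}. totally_disconnected_in (Euclidean_space l) (coord_proj l ` K)) \<longleftrightarrow>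
          (\<forall>l<d. \<forall>u\<in>projected_ifs N T b l. \<forall>A.
             is_attractor euclideanreal (fiber_ifs N T b l u) A \<longrightarrow> A \<noteq> {0..1}))"
    (is "(?ud \<longleftrightarrow> ?td) \<and> (_ \<longleftrightarrow> ?fib)")
proof -
  interpret box_ifs d N T b by (rule lalley_gatzouras_box_ifs) fact
  note K_cube = assms(4)
  have K_ne: "K \<noteq> {}" and K_compactin: "compactin (Euclidean_space d) K"
    and K_inv: "K = (\<Union>f\<in>projected_ifs N T b d. f ` K)"
    using assms(3) by (auto simp: is_attractor_def)
  have K_top: "K \<subseteq> topspace (Euclidean_space d)" by (rule compactin_subset_topspace) fact
  have K_compact: "compact K"
    using K_compactin by (simp add: Euclidean_space_def compactin_subtopology euclidean_product_topology)
  have inv: "diag_affine d (T k) (b k) x \<in> K" if "k < N" "x \<in> K" for k x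
    by (subst K_inv) (use that in \<open>auto simp: projected_ifs_def\<close>)
  have coded: "\<exists>\<omega>. codes \<omega> x" if "x \<in> K" for x
    using codes_exists[OF equalityD1[OF K_inv] K_cube that] by blast
  \<comment> \<open>The fiber condition yields both forms of disconnectedness, and by
    \<open>neg\<close> its failure refutes both; this gives all equivalences.\<close>
  have pos: "?ud \<and> ?td" if ?fib
  proof -
    have "\<exists>\<epsilon>>0. fiber_gap l \<epsilon>" if l: "l < d" for l
    proof (rule fiber_gap_exists[OF l])
      fix k assume k: "k < N"
      let ?F = "\<Union>k'\<in>{k'. k' < N \<and> same_proj T b l k k'}. {b k' l..b k' l + T k' l}"
      have "diag_affine l (T k) (b k) \<in> projected_ifs N T b l" using k by (auto simp: projected_ifs_def)
      then have "{0..1} \<noteq> ?F"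
        using \<open>?fib\<close> l unfolding fiber_attractor_unit_iff[OF k l, symmetric] by blast
      \<comment> \<open>Since the first-generation intervals lie in [0,1], differing from [0,1]
        means missing a point of it.\<close>
      moreover have "?F \<subseteq> {0..1}"
        using b_nonneg[OF _ l] b_T_le_1[OF _ l] by (fastforce intro: order_trans)
      ultimately obtain t where "t \<in> {0..1}" "t \<notin> ?F" by blast
      then show "\<exists>t\<in>{0..1}. \<forall>k'<N. same_proj T b l k k' \<longrightarrow> t \<notin> {b k' l..b k' l + T k' l}" by blast
    qed
    note bound = chain_bound_exists[OF this]
    show ?thesis
    proof (intro conjI ballI)
      obtain C where "0 \<le> C" "chain_bound d C" using bound[of d] by blast
      then show ?ud using uniformly_disconnected_if_chain_bound coded K_top by blast
      fix l assume "l \<in> {1..d}"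
      then obtain C where "0 \<le> C" "chain_bound l C" using bound[of l] by auto
      then show "totally_disconnected_in (Euclidean_space l) (coord_proj l ` K)"
        using totally_disconnected_if_chain_bound coded by blast
    qed
  qed
  have neg: "\<not> ?ud \<and> \<not> ?td" if "\<not> ?fib"
  proof -
    from that obtain l k where l: "l < d" and k: "k < N"
      and "is_attractor euclideanreal (fiber_ifs N T b l (diag_affine l (T k) (b k))) {0..1}"
      by (auto simp: projected_ifs_def)
    then have covered:
      "{0..1} \<subseteq> (\<Union>k'\<in>{k'. k' < N \<and> same_proj T b l k k'}. {b k' l..b k' l + T k' l})"
      using fiber_attractor_unit_iff[OF k l] by blast
    obtain x where x: "\<And>t. t \<in> {0..1} \<Longrightarrow> x t \<in> K" "\<And>t. t \<in> {0..1} \<Longrightarrow> x t l = t"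
      "\<And>t t' i. t \<in> {0..1} \<Longrightarrow> t' \<in> {0..1} \<Longrightarrow> i < l \<Longrightarrow> x t i = x t' i"
      using fiber_segment[OF K_compact K_ne K_cube inv k l covered] by blast
    have "\<not> ?ud" by (rule segment_not_uniformly_disconnected[OF x K_cube inv k l])
    moreover have "\<not> totally_disconnected_in (Euclidean_space (Suc l)) (coord_proj (Suc l) ` K)"
      by (rule segment_not_totally_disconnected[OF x])
    ultimately show ?thesis using l by force
  qed
  from pos neg show ?thesis by blast
qed

end
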